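(* Let $\nu\in\mathbb{N}$ with $\nu>1$ and assume $\mathcal{J}=\{\Phi\in\mathcal{S}_+^m(\mathbb{T}):\int G\Phi G^*=I\}$ is non-empty. Then the dual problem $$\max\{J_\nu(\Lambda):\Lambda\in\mathcal{L}_+\},\qquad J_\nu(\Lambda)=\frac{\nu}{1-\nu}\int\operatorname{tr}\Big[\Big(I+\tfrac{1}{\nu}W_\Psi^*G^*\Lambda GW_\Psi\Big)^{1-\nu}\Big]-\operatorname{tr}[\Lambda],$$ admits a unique solution $\Lambda^\circ$, and it satisfies $\int G\,\Phi_\nu(\Lambda^\circ)\,G^*=I$, where $\Phi_\nu(\Lambda)=W_\Psi\big(I+\tfrac{1}{\nu}W_\Psi^*G^*\Lambda GW_\Psi\big)^{-\nu}W_\Psi^*$.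
   Context: Integration $\int f$ denotes $\frac{1}{2\pi}\int_{-\pi}^{\pi} f(e^{j\vartheta})\,d\vartheta$; a star denotes conjugate transpose. $\mathcal{S}_+^m(\mathbb{T})$: measurable, bounded, coercive, Hermitian $\mathbb{C}^{m\times m}$-valued spectral densities on the unit circle $\mathbb{T}$. $\Psi\in\mathcal{S}_+^m(\mathbb{T})$ is rational, with canonical left spectral factor $W_\Psi$ (outer, $\det W_\Psi\neq0$ on $\{|z|\ge1\}$, $W_\Psi(\infty)$ lower triangular with positive diagonal, $\Psi=W_\Psi W_\Psi^*$ on $\mathbb{T}$). $\mathcal{Q}_n$: real symmetric $n\times n$ matrices. Data: $n>m$, $A\in\mathbb{R}^{n\times n}$ with all eigenvalues in the open unit disk, $B\in\mathbb{R}^{n\times m}$ of full column rank, $(A,B)$ reachable, $\hat\Sigma\in\mathcal{Q}_n$ positive definite, $G(z)=\hat\Sigma^{-1/2}(zI-A)^{-1}B$. $\mathcal{Q}_n^G:=\{\int G\Phi G^*:\Phi\in\mathcal{V}(\mathcal{S}_+^m(\mathbb{T}))\}$ with $\mathcal{V}(\cdot)$ the real linear span; $\mathcal{L}_+:=\{\Lambda\in\mathcal{Q}_n^G: I+\tfrac1\nu W_\Psi^*G^*\Lambda GW_\Psi\succ0\text{ on }\mathbb{T}\}$. *)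

theory Defs
  imports "HOL-Analysis.Analysis" "HOL-Computational_Algebra.Polynomial"
begin

definition circ :: "complex set" where
  "circ = sphere 0 1"

definition cint :: "(complex \<Rightarrow> 'a::real_normed_vector) \<Rightarrow> 'a" where
  "cint f = (1 / (2 * pi)) *\<^sub>R integral {-pi..pi} (\<lambda>\<theta>. f (cis \<theta>))"

definition ctrans :: "complex^'n^'m \<Rightarrow> complex^'m^'n" where
  "ctrans M = (\<chi> i j. cnj (M $ j $ i))"

definition cmat :: "real^'n^'m \<Rightarrow> complex^'n^'m" where
  "cmat M = (\<chi> i j. complex_of_real (M $ i $ j))"

definition cqform :: "complex^'n^'n \<Rightarrow> complex^'n \<Rightarrow> complex" where
  "cqform M x = (\<Sum>i\<in>UNIV. cnj (x $ i) * (M *v x) $ i)"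

definition cposdef :: "complex^'n^'n \<Rightarrow> bool" where
  "cposdef M \<longleftrightarrow> ctrans M = M \<and> (\<forall>x. x \<noteq> 0 \<longrightarrow> 0 < Re (cqform M x))"

definition rposdef :: "real^'n^'n \<Rightarrow> bool" where
  "rposdef M \<longleftrightarrow> transpose M = M \<and> (\<forall>x. x \<noteq> 0 \<longrightarrow> 0 < x \<bullet> (M *v x))"

definition msqrt :: "real^'n^'n \<Rightarrow> real^'n^'n" where
  "msqrt S = (THE R. rposdef R \<and> R ** R = S)"

definition mpow :: "'a::semiring_1^'n^'n \<Rightarrow> nat \<Rightarrow> 'a^'n^'n" where
  "mpow M k = ((\<lambda>X. X ** M) ^^ k) (mat 1)"

definition mpowi :: "'a::semiring_1^'n^'n \<Rightarrow> int \<Rightarrow> 'a^'n^'n" where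
  "mpowi M k = (if 0 \<le> k then mpow M (nat k) else mpow (matrix_inv M) (nat (- k)))"

definition Splus :: "(complex \<Rightarrow> complex^'m^'m) set" where
  "Splus = {\<Phi>. (\<lambda>\<theta>. \<Phi> (cis \<theta>)) \<in> borel_measurable lebesgue
     \<and> (\<exists>C. \<forall>z\<in>circ. norm (\<Phi> z) \<le> C)
     \<and> (\<exists>\<epsilon>>0. \<forall>z\<in>circ. \<forall>x. \<epsilon> * (norm x)\<^sup>2 \<le> Re (cqform (\<Phi> z) x))
     \<and> (\<forall>z\<in>circ. ctrans (\<Phi> z) = \<Phi> z)}"

definition rspan :: "(complex \<Rightarrow> complex^'m^'m) set \<Rightarrow> (complex \<Rightarrow> complex^'m^'m) set" where
  "rspan S = {(\<lambda>z. \<Sum>i<k. c i *\<^sub>R F i z) | (k::nat) c F. \<forall>i<k. F i \<in> S}"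

definition rational_on_circ :: "(complex \<Rightarrow> complex^'m^'k) \<Rightarrow> bool" where
  "rational_on_circ F \<longleftrightarrow> (\<forall>i j. \<exists>p q :: complex poly.
      \<forall>z\<in>circ. poly q z \<noteq> 0 \<and> F z $ i $ j = poly p z / poly q z)"

text \<open>Canonical left spectral factor of a rational density Psi: rational, analytic
  in |z| >= 1 including infinity (proper, poles in the open unit disk), outer
  (det nonzero on |z| >= 1), value at infinity lower triangular with positive
  diagonal, and Psi = W W^* on the unit circle.\<close>
definition canonical_left_factor ::
  "(complex \<Rightarrow> ((complex, 'm::{finite,linorder}) vec, 'm) vec) \<Rightarrow> (complex \<Rightarrow> ((complex, 'm) vec, 'm) vec) \<Rightarrow> bool" where
  "canonical_left_factor W \<Psi> \<longleftrightarrow>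
     (\<forall>i j. \<exists>p q :: complex poly. degree p \<le> degree q
         \<and> (\<forall>z. poly q z = 0 \<longrightarrow> cmod z < 1)
         \<and> (\<forall>z. 1 \<le> cmod z \<longrightarrow> W z $ i $ j = poly p z / poly q z))
   \<and> (\<forall>z. 1 \<le> cmod z \<longrightarrow> det (W z) \<noteq> 0)
   \<and> (\<exists>Winf. (W \<longlongrightarrow> Winf) at_infinity
         \<and> (\<forall>i j. i < j \<longrightarrow> Winf $ i $ j = 0)
         \<and> (\<forall>i. Winf $ i $ i \<in> \<real> \<and> 0 < Re (Winf $ i $ i)))
   \<and> (\<forall>z\<in>circ. \<Psi> z = W z ** ctrans (W z))"

definition reachable :: "real^'n^'n \<Rightarrow> real^'m^'n \<Rightarrow> bool" where
  "reachable A B \<longleftrightarrow>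
     span {column j (mpow A k ** B) | j k. k < CARD('n)} = (UNIV :: (real^'n) set)"

definition stable :: "real^'n^'n \<Rightarrow> bool" where
  "stable A \<longleftrightarrow> (\<forall>l::complex. (\<exists>v. v \<noteq> 0 \<and> cmat A *v v = l *s v) \<longrightarrow> cmod l < 1)"

definition Gfun :: "real^'n^'n \<Rightarrow> real^'n^'n \<Rightarrow> real^'m^'n \<Rightarrow> complex \<Rightarrow> complex^'m^'n" where
  "Gfun Sig A B z = cmat (matrix_inv (msqrt Sig)) ** matrix_inv (mat z - cmat A) ** cmat B"

definition QG :: "(complex \<Rightarrow> complex^'m^'n) \<Rightarrow> (complex^'n^'n) set" where
  "QG G = {cint (\<lambda>z. G z ** \<Phi> z ** ctrans (G z)) | \<Phi>. \<Phi> \<in> rspan Splus}"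

definition Mop :: "nat \<Rightarrow> (complex \<Rightarrow> complex^'m^'m) \<Rightarrow> (complex \<Rightarrow> complex^'m^'n)
      \<Rightarrow> complex^'n^'n \<Rightarrow> complex \<Rightarrow> complex^'m^'m" where
  "Mop \<nu> W G \<Lambda> z = mat 1 + (1 / of_nat \<nu>) *\<^sub>R (ctrans (W z) ** ctrans (G z) ** \<Lambda> ** G z ** W z)"

definition Lplus :: "nat \<Rightarrow> (complex \<Rightarrow> complex^'m^'m) \<Rightarrow> (complex \<Rightarrow> complex^'m^'n)
      \<Rightarrow> (complex^'n^'n) set" where
  "Lplus \<nu> W G = {\<Lambda> \<in> QG G. \<forall>z\<in>circ. cposdef (Mop \<nu> W G \<Lambda> z)}"

definition Jnu :: "nat \<Rightarrow> (complex \<Rightarrow> complex^'m^'m) \<Rightarrow> (complex \<Rightarrow> complex^'m^'n)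
      \<Rightarrow> complex^'n^'n \<Rightarrow> real" where
  "Jnu \<nu> W G \<Lambda> = real \<nu> / (1 - real \<nu>)
       * Re (cint (\<lambda>z. trace (mpowi (Mop \<nu> W G \<Lambda> z) (1 - int \<nu>)))) - Re (trace \<Lambda>)"

definition Phinu :: "nat \<Rightarrow> (complex \<Rightarrow> complex^'m^'m) \<Rightarrow> (complex \<Rightarrow> complex^'m^'n)
      \<Rightarrow> complex^'n^'n \<Rightarrow> complex \<Rightarrow> complex^'m^'m" where
  "Phinu \<nu> W G \<Lambda> z = W z ** mpowi (Mop \<nu> W G \<Lambda> z) (- int \<nu>) ** ctrans (W z)"

end

theory Submission
  imports Defs
begin

text \<open>On the Euclidean space of complex matrices the inner product is \<open>A \<bullet> B = Re tr (A\<^sup>* B)\<close>, and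
  \<open>\<Lambda> \<bullet> \<integral> G \<Phi> G\<^sup>* = \<integral> (G\<^sup>* \<Lambda> G) \<bullet> \<Phi>\<close>. Hence an element \<open>\<Lambda>\<close> of the span \<open>QG G\<close> with \<open>G\<^sup>* \<Lambda> G = 0\<close> on the
  circle is orthogonal to itself and vanishes.

  With \<open>M \<Lambda> = I + W\<^sup>* G\<^sup>* \<Lambda> G W / \<nu>\<close>, Klein's inequality for \<open>N \<mapsto> tr N\<^sup>1\<^sup>-\<^sup>\<nu>\<close> makes
  \<open>\<integral> G \<Phi>\<^sub>\<nu>(\<Lambda>) G\<^sup>* - I\<close>, which lies in \<open>QG G\<close>, a supergradient of the dual functional \<open>J\<^sub>\<nu>\<close> at \<open>\<Lambda>\<close>, with a
  strict inequality unless \<open>M\<close> is unchanged. So a maximizer is unique, and its supergradient is zero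
  as soon as it has room to move in \<open>Lplus\<close>.

  A maximizer exists because superlevel sets are compact. A feasible coercive density \<open>\<Phi>\<close> gives
  \<open>tr \<Lambda> = \<integral> (G\<^sup>* \<Lambda> G) \<bullet> \<Phi>\<close>, which bounds the \<open>L\<^sup>1\<close> norm of \<open>G\<^sup>* \<Lambda> G\<close> and hence \<open>\<Lambda>\<close>. The boundary is
  never approached: \<open>M \<Lambda>\<close> is Lipschitz along the circle, so where its least eigenvalue nearly
  vanishes, \<open>\<integral> tr (M \<Lambda>)\<^sup>1\<^sup>-\<^sup>\<nu>\<close> is at least of the size of \<open>\<integral> 1 / (s + L \<bar>\<theta>\<bar>)\<close>, which diverges
  logarithmically as \<open>s \<rightarrow> 0\<close> already for \<open>\<nu> = 2\<close>.\<close>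

section \<open>Complex matrices as a Euclidean space\<close>

text \<open>The norm of a matrix, taken as a vector of rows, is the Frobenius norm, so
  Cauchy-Schwarz in each row suffices.\<close>

lemma norm_matrix_vector_mult_le:
  fixes A :: "complex^'n^'m"
  shows "norm (A *v x) \<le> norm A * norm x"
proof -
  have row: "norm ((A *v x) $ i) \<le> norm (A $ i) * norm x" for i
  proof -
    have "norm ((A *v x) $ i) \<le> (\<Sum>k\<in>UNIV. \<bar>norm (A $ i $ k)\<bar> * \<bar>norm (x $ k)\<bar>)"
      unfolding matrix_vector_mult_def by (auto intro!: sum_norm_le simp: norm_mult)
    also have "\<dots> \<le> norm (A $ i) * norm x"
      unfolding norm_vec_def by (rule L2_set_mult_ineq)
    finally show ?thesis .
  qed
  have "norm (A *v x) \<le> L2_set (\<lambda>i. norm (A $ i) * norm x) UNIV"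
    unfolding norm_vec_def[of "A *v x"] by (rule L2_set_mono) (auto simp: row)
  also have "\<dots> = norm A * norm x"
    by (simp add: L2_set_left_distrib norm_vec_def[of A])
  finally show ?thesis .
qed

lemma norm_matrix_matrix_mult_le:
  fixes A :: "complex^'n^'m" and B :: "complex^'p^'n"
  shows "norm (A ** B) \<le> norm A * norm B"
proof -
  have row: "norm ((A ** B) $ i) \<le> norm (A $ i) * norm B" for i
  proof -
    have "(A ** B) $ i = (\<Sum>k\<in>UNIV. A $ i $ k *s B $ k)"
      by (simp add: matrix_matrix_mult_def vec_eq_iff)
    also have "norm \<dots> \<le> (\<Sum>k\<in>UNIV. \<bar>norm (A $ i $ k)\<bar> * \<bar>norm (B $ k)\<bar>)"
    proof (rule sum_norm_le)
      fix k
      have "norm (A $ i $ k *s B $ k) = norm (A $ i $ k) * norm (B $ k)"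
        by (simp add: norm_vec_def norm_mult L2_set_right_distrib)
      then show "norm (A $ i $ k *s B $ k) \<le> \<bar>norm (A $ i $ k)\<bar> * \<bar>norm (B $ k)\<bar>"
        by simp
    qed
    also have "\<dots> \<le> norm (A $ i) * norm B"
      unfolding norm_vec_def[of "A $ i"] norm_vec_def[of B] by (rule L2_set_mult_ineq)
    finally show ?thesis .
  qed
  have "norm (A ** B) \<le> L2_set (\<lambda>i. norm (A $ i) * norm B) UNIV"
    unfolding norm_vec_def[of "A ** B"] by (rule L2_set_mono) (auto simp: row)
  also have "\<dots> = norm A * norm B"
    by (simp add: L2_set_left_distrib norm_vec_def[of A])
  finally show ?thesis .
qed

text \<open>Submultiplicativity gives the constant 1. Continuity, distributivity and scaling of
  matrix products are all drawn from this one fact.\<close>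

lemma bounded_bilinear_matrix_matrix_mult:
  "bounded_bilinear ((**) :: complex^'n^'m \<Rightarrow> complex^'p^'n \<Rightarrow> complex^'p^'m)"
proof
  show "\<exists>K. \<forall>(A::complex^'n^'m) (B::complex^'p^'n). norm (A ** B) \<le> norm A * norm B * K"
    by (rule exI[of _ 1]) (simp add: norm_matrix_matrix_mult_le)
qed (simp_all add: matrix_matrix_mult_def vec_eq_iff sum.distrib distrib_left distrib_right
      scaleR_sum_right)

lemma bounded_bilinear_matrix_vector_mult:
  "bounded_bilinear ((*v) :: complex^'n^'m \<Rightarrow> complex^'n \<Rightarrow> complex^'m)"
proof
  show "\<exists>K. \<forall>(A::complex^'n^'m) (x::complex^'n). norm (A *v x) \<le> norm A * norm x * K"
    by (rule exI[of _ 1]) (simp add: norm_matrix_vector_mult_le)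
qed (simp_all add: matrix_vector_mult_def vec_eq_iff sum.distrib distrib_left distrib_right
      scaleR_sum_right)

lemmas continuous_on_matrix_mult [continuous_intros] =
  bounded_bilinear.continuous_on[OF bounded_bilinear_matrix_matrix_mult]
  bounded_bilinear.continuous_on[OF bounded_bilinear_matrix_vector_mult]

lemmas matrix_mult_algebra =
  bounded_bilinear.add_left[OF bounded_bilinear_matrix_matrix_mult]
  bounded_bilinear.add_right[OF bounded_bilinear_matrix_matrix_mult]
  bounded_bilinear.diff_left[OF bounded_bilinear_matrix_matrix_mult]
  bounded_bilinear.diff_right[OF bounded_bilinear_matrix_matrix_mult]
  bounded_bilinear.scaleR_left[OF bounded_bilinear_matrix_matrix_mult]
  bounded_bilinear.scaleR_right[OF bounded_bilinear_matrix_matrix_mult]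

lemmas matrix_vector_mult_algebra =
  bounded_bilinear.add_left[OF bounded_bilinear_matrix_vector_mult]
  bounded_bilinear.add_right[OF bounded_bilinear_matrix_vector_mult]
  bounded_bilinear.diff_left[OF bounded_bilinear_matrix_vector_mult]
  bounded_bilinear.diff_right[OF bounded_bilinear_matrix_vector_mult]
  bounded_bilinear.scaleR_left[OF bounded_bilinear_matrix_vector_mult]
  bounded_bilinear.scaleR_right[OF bounded_bilinear_matrix_vector_mult]

lemma ctrans_matrix_mult: "ctrans (A ** B) = ctrans B ** ctrans A"
  by (simp add: ctrans_def matrix_matrix_mult_def vec_eq_iff mult.commute)

lemma ctrans_ctrans [simp]: "ctrans (ctrans A) = A"
  by (simp add: ctrans_def vec_eq_iff)

lemma ctrans_mat_1 [simp]: "ctrans (mat 1) = mat 1"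
  by (auto simp: ctrans_def mat_def vec_eq_iff)

lemma norm_ctrans [simp]: "norm (ctrans A) = norm A"
proof -
  have "(norm (ctrans A))\<^sup>2 = (norm A)\<^sup>2"
    by (simp add: power2_norm_eq_inner inner_vec_def ctrans_def inner_complex_def)
      (rule sum.swap)
  then show ?thesis by simp
qed

lemma bounded_linear_ctrans: "bounded_linear (ctrans :: complex^'n^'m \<Rightarrow> complex^'m^'n)"
  by (rule bounded_linear_intro[where K=1])
    (simp_all, simp_all add: ctrans_def vec_eq_iff)

lemmas continuous_on_ctrans [continuous_intros] =
  bounded_linear.continuous_on[OF bounded_linear_ctrans]

lemmas ctrans_linear =
  linear_add[OF bounded_linear.linear[OF bounded_linear_ctrans]]
  linear_diff[OF bounded_linear.linear[OF bounded_linear_ctrans]]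
  linear_scale[OF bounded_linear.linear[OF bounded_linear_ctrans]]
  linear_sum[OF bounded_linear.linear[OF bounded_linear_ctrans]]

text \<open>Entrywise, multiplication by \<open>b\<close> on the real plane has multiplication by
  \<open>cnj b\<close> as its adjoint; the rest is an exchange of sums.\<close>

lemma inner_matrix_mult_right:
  fixes A :: "complex^'n^'m" and B :: "complex^'p^'n"
  shows "(A ** B) \<bullet> C = A \<bullet> (C ** ctrans B)"
proof -
  have *: "(a * b) \<bullet> c = a \<bullet> (c * cnj b)" for a b c :: complex
    by (simp add: inner_complex_def algebra_simps)
  have "(A ** B) \<bullet> C = (\<Sum>i\<in>UNIV. \<Sum>j\<in>UNIV. \<Sum>k\<in>UNIV. A$i$k \<bullet> (C$i$j * cnj (B$k$j)))"
    by (simp add: inner_vec_def matrix_matrix_mult_def inner_sum_left *)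
  also have "\<dots> = A \<bullet> (C ** ctrans B)"
    by (simp add: inner_vec_def matrix_matrix_mult_def inner_sum_right ctrans_def)
      (intro sum.cong refl, rule sum.swap)
  finally show ?thesis .
qed

lemma inner_ctrans: "ctrans A \<bullet> ctrans B = A \<bullet> B"
  by (simp add: inner_vec_def ctrans_def inner_complex_def) (rule sum.swap)

text \<open>Conjugate transposition preserves the inner product and exchanges left and right
  multiplication.\<close>

lemma inner_matrix_mult_left:
  fixes A :: "complex^'n^'m" and B :: "complex^'p^'n"
  shows "(A ** B) \<bullet> C = B \<bullet> (ctrans A ** C)"
proof -
  have "(A ** B) \<bullet> C = (ctrans B ** ctrans A) \<bullet> ctrans C"
    by (simp only: inner_ctrans ctrans_matrix_mult[symmetric])
  also have "\<dots> = ctrans B \<bullet> ctrans (ctrans A ** C)"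
    by (simp only: inner_matrix_mult_right ctrans_matrix_mult ctrans_ctrans)
  finally show ?thesis by (simp only: inner_ctrans)
qed

lemma inner_matrix_vector_mult:
  fixes A :: "complex^'n^'m"
  shows "(A *v x) \<bullet> y = x \<bullet> (ctrans A *v y)"
proof -
  have *: "(a * b) \<bullet> c = b \<bullet> (cnj a * c)" for a b c :: complex
    by (simp add: inner_complex_def algebra_simps)
  show ?thesis
    by (simp add: inner_vec_def matrix_vector_mult_def inner_sum_left inner_sum_right ctrans_def *)
      (rule sum.swap)
qed

lemma Re_cqform: "Re (cqform M x) = x \<bullet> (M *v x)"
  by (simp add: cqform_def inner_vec_def inner_complex_def)

lemma Re_trace: "Re (trace M) = mat 1 \<bullet> M"
proof -
  have *: "(if b then 1 else 0 :: complex) \<bullet> z = (if b then Re z else 0)" for b and z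
    by (simp add: inner_complex_def)
  show ?thesis
    by (simp add: trace_def inner_vec_def mat_def * cong: if_cong)
qed

section \<open>Positive semidefinite matrices\<close>

definition psd :: "complex^'n^'n \<Rightarrow> bool" where
  "psd M \<longleftrightarrow> ctrans M = M \<and> (\<forall>x. 0 \<le> x \<bullet> (M *v x))"

lemma cposdef_alt: "cposdef M \<longleftrightarrow> ctrans M = M \<and> (\<forall>x. x \<noteq> 0 \<longrightarrow> 0 < x \<bullet> (M *v x))"
  by (simp add: cposdef_def Re_cqform)

lemma cposdef_imp_psd: "cposdef M \<Longrightarrow> psd M"
  unfolding cposdef_alt psd_def by (metis inner_zero_left order.refl less_imp_le)

lemma psd_ctrans_mult:
  assumes "psd M"
  shows "psd (ctrans A ** M ** A)"
proof -
  have "x \<bullet> (ctrans A ** M ** A *v x) = (A *v x) \<bullet> (M *v (A *v x))" for x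
    by (simp only: inner_matrix_vector_mult matrix_vector_mul_assoc matrix_mul_assoc)
  then show ?thesis
    using assms by (simp add: psd_def ctrans_matrix_mult matrix_mul_assoc)
qed

text \<open>The rank-one matrix \<open>v v*\<close>. Sums of such matrices take the place of a
  spectral decomposition below.\<close>

definition outer_prod :: "complex^'n \<Rightarrow> complex^'n^'n" where
  "outer_prod v = (\<chi> i j. v $ i * cnj (v $ j))"

lemma outer_prod_vector_mult:
  "x \<bullet> (outer_prod v *v x) = (cmod (\<Sum>i\<in>UNIV. cnj (v$i) * x$i))\<^sup>2"
proof -
  define s where "s = (\<Sum>i\<in>UNIV. cnj (v$i) * x$i)"
  have ov: "(outer_prod v *v x) $ i = v$i * s" for i
    by (simp add: outer_prod_def matrix_vector_mult_def s_def sum_distrib_left mult.assoc)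
  have "cqform (outer_prod v) x = (\<Sum>i\<in>UNIV. cnj (x$i) * v$i) * s"
    by (simp add: cqform_def ov sum_distrib_right mult.assoc)
  also have "(\<Sum>i\<in>UNIV. cnj (x$i) * v$i) = cnj s"
    by (simp add: s_def mult.commute)
  finally have "cqform (outer_prod v) x = s * cnj s" by simp
  then have "Re (cqform (outer_prod v) x) = (cmod s)\<^sup>2"
    by (simp only: complex_norm_square[symmetric] Re_complex_of_real)
  then show ?thesis by (simp only: Re_cqform s_def)
qed

lemma ctrans_outer_prod [simp]: "ctrans (outer_prod v) = outer_prod v"
  by (simp add: ctrans_def outer_prod_def vec_eq_iff mult.commute)

lemma inner_outer_prod: "outer_prod v \<bullet> Q = v \<bullet> (Q *v v)"
proof -
  have *: "(a * cnj b) \<bullet> c = a \<bullet> (c * b)" for a b c :: complex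
    by (simp add: inner_complex_def algebra_simps)
  show ?thesis
    by (simp add: inner_vec_def outer_prod_def matrix_vector_mult_def inner_sum_right *)
qed

text \<open>Cauchy-Schwarz for the semi-inner product of \<open>P\<close>, applied to
  \<open>x\<close> and the \<open>i\<close>-th unit vector.\<close>

lemma psd_cauchy_schwarz:
  assumes "psd P"
  shows "(cmod ((P *v x) $ i))\<^sup>2 \<le> Re (P$i$i) * (x \<bullet> (P *v x))"
proof -
  define w q a where "w = (P *v x) $ i" and "q = x \<bullet> (P *v x)" and "a = Re (P$i$i)"
  have herm: "ctrans P = P" and nonneg: "\<And>y. 0 \<le> y \<bullet> (P *v y)"
    using assms by (auto simp: psd_def)
  have "cnj (P$i$i) = P$i$i"
    using herm by (simp add: ctrans_def vec_eq_iff)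
  then have Pii: "P$i$i = complex_of_real a"
    by (simp add: a_def complex_eq_iff)
  have Pe: "(P *v axis i t) $ i = complex_of_real a * t" for t
    by (simp add: matrix_vector_mult_def axis_def if_distrib[of "(*) _"] Pii cong: if_cong)
  have key: "0 \<le> q - 2 * s * (cmod w)\<^sup>2 + s\<^sup>2 * (cmod w)\<^sup>2 * a" for s
  proof -
    \<comment> \<open>The phase of \<open>w\<close> makes the cross term real, so positivity at
      \<open>x + e\<close> becomes a real quadratic inequality in \<open>s\<close>.\<close>
    define t where "t = - of_real s * w"
    have cw: "(cmod w)\<^sup>2 = Re w * Re w + Im w * Im w"
      by (simp only: cmod_power2) (simp only: power2_eq_square)
    define e where "e = (axis i t :: complex^'a)"
    have ePx: "e \<bullet> (P *v x) = - s * (cmod w)\<^sup>2"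
      by (simp add: e_def inner_axis' w_def[symmetric] t_def inner_complex_def cw
          algebra_simps power2_eq_square[of s])
    have xPe: "x \<bullet> (P *v e) = e \<bullet> (P *v x)"
      using inner_matrix_vector_mult[of P x e] herm by (simp add: inner_commute)
    have ePe: "e \<bullet> (P *v e) = s\<^sup>2 * (cmod w)\<^sup>2 * a"
      by (simp add: e_def inner_axis' Pe t_def inner_complex_def cw
          algebra_simps power2_eq_square[of s])
    have "(x + e) \<bullet> (P *v (x + e)) = q + 2 * (e \<bullet> (P *v x)) + e \<bullet> (P *v e)"
      by (simp add: matrix_vector_mult_algebra inner_add_left inner_add_right xPe q_def)
    then show ?thesis using nonneg[of "x + e"] ePx ePe by simp
  qed
  have "a = axis i 1 \<bullet> (P *v axis i 1)"
    by (simp add: inner_axis' Pe inner_complex_def)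
  then have a0: "0 \<le> a" using nonneg by simp
  have "(cmod w)\<^sup>2 \<le> a * q"
  proof (cases "a = 0")
    case True
    have "cmod w = 0"
    proof (rule ccontr)
      assume "cmod w \<noteq> 0"
      \<comment> \<open>With \<open>a = 0\<close> the quadratic is affine in \<open>s\<close>; this
        value of \<open>s\<close> makes it equal to -1.\<close>
      then have "2 * ((q + 1) / (2 * (cmod w)\<^sup>2)) * (cmod w)\<^sup>2 = q + 1" by simp
      with key[of "(q + 1) / (2 * (cmod w)\<^sup>2)"] True show False by simp
    qed
    then show ?thesis by (simp add: True)
  next
    case False
    then have "0 < a" using a0 by simp
    with key[of "1 / a"] show ?thesis
      by (simp add: field_simps power2_eq_square)
  qed
  then show ?thesis by (simp add: w_def q_def a_def)
qed

text \<open>Symmetric elimination as in a Cholesky factorization: subtracting one rank-one matrix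
  clears a nonzero row, keeps zero rows zero and leaves a positive semidefinite Schur complement, so
  the number of nonzero rows drops.\<close>

lemma psd_imp_sum_outer_prod:
  assumes "psd P"
  shows "\<exists>vs. P = sum_list (map outer_prod vs)"
  using assms
proof (induction "card {i. P $ i \<noteq> 0}" arbitrary: P rule: less_induct)
  case less
  show ?case
  proof (cases "P = 0")
    case True
    then show ?thesis by (intro exI[of _ "[]"]) simp
  next
    case False
    then obtain i where i: "P $ i \<noteq> 0" by (auto simp: vec_eq_iff)
    then obtain j where j: "P $ i $ j \<noteq> 0" by (auto simp: vec_eq_iff)
    have herm: "ctrans P = P" and nonneg: "\<And>y. 0 \<le> y \<bullet> (P *v y)"
      using less.prems by (auto simp: psd_def)
    have sym: "cnj (P $ k $ l) = P $ l $ k" for k l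
      using herm by (simp add: ctrans_def vec_eq_iff)
    have Pj: "(P *v axis j 1) $ k = P $ k $ j" for k
      by (simp add: matrix_vector_mult_def axis_def if_distrib[of "(*) _"] cong: if_cong)
    define a where "a = Re (P$i$i)"
    \<comment> \<open>Cauchy-Schwarz forces a positive diagonal entry in every nonzero row, so
      \<open>a\<close> can serve as the pivot.\<close>
    have "0 < (cmod ((P *v axis j 1) $ i))\<^sup>2" using j by (simp add: Pj)
    also note psd_cauchy_schwarz[OF less.prems]
    finally have "0 < a * (axis j 1 \<bullet> (P *v axis j 1))" by (simp add: a_def)
    then have a: "0 < a" using nonneg[of "axis j 1"] by (simp add: zero_less_mult_iff)
    have Pii: "P$i$i = complex_of_real a"
      using sym[of i i] by (simp add: a_def complex_eq_iff)
    \<comment> \<open>The \<open>i\<close>-th column over the root of the pivot: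
      \<open>outer_prod v\<close> then agrees with \<open>P\<close> in row and column
      \<open>i\<close>.\<close>
    define v where "v = (\<chi> k. P $ k $ i / of_real (sqrt a))"
    have sq: "complex_of_real (sqrt a) * of_real (sqrt a) = of_real a"
      using a by (simp flip: of_real_mult)
    have ov: "outer_prod v $ k $ l = P $ k $ i * P $ i $ l / of_real a" for k l
      by (simp add: outer_prod_def v_def sym sq)
    define Q where "Q = P - outer_prod v"
    have "psd Q"
      unfolding psd_def
    proof (intro conjI allI)
      show "ctrans Q = Q" by (simp add: Q_def ctrans_linear herm)
      fix x
      have "(\<Sum>k\<in>UNIV. cnj (v$k) * x$k) = (P *v x) $ i / of_real (sqrt a)"
        by (simp add: v_def sym matrix_vector_mult_def sum_divide_distrib)
      then have "x \<bullet> (outer_prod v *v x) = (cmod ((P *v x) $ i))\<^sup>2 / a"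
        using a by (simp add: outer_prod_vector_mult norm_divide power_divide)
      also have "\<dots> \<le> x \<bullet> (P *v x)"
        using psd_cauchy_schwarz[OF less.prems, of x i] a by (simp add: a_def field_simps)
      finally show "0 \<le> x \<bullet> (Q *v x)"
        by (simp add: Q_def matrix_vector_mult_algebra inner_diff_right)
    qed
    have "Q $ i = 0"
      using a by (simp add: Q_def vec_eq_iff ov Pii)
    moreover have "Q $ k = 0" if "P $ k = 0" for k
      using that by (simp add: Q_def vec_eq_iff ov)
    ultimately have "{k. Q $ k \<noteq> 0} \<subset> {k. P $ k \<noteq> 0}"
      using i by blast
    then have "card {k. Q $ k \<noteq> 0} < card {k. P $ k \<noteq> 0}"
      by (intro psubset_card_mono) auto
    from less.hyps[OF this \<open>psd Q\<close>] obtain vs where "Q = sum_list (map outer_prod vs)"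
      by blast
    then have "P = sum_list (map outer_prod (v # vs))"
      by (simp add: Q_def algebra_simps)
    then show ?thesis by blast
  qed
qed

lemma inner_sum_list_outer_prod:
  "P \<bullet> sum_list (map outer_prod vs) = (\<Sum>v\<leftarrow>vs. v \<bullet> (P *v v))"
  by (induction vs) (simp_all add: inner_add_right inner_commute[of P] inner_outer_prod)

text \<open>Self-duality of the positive semidefinite cone: a rank-one decomposition of
  \<open>Q\<close> turns the pairing into a sum of values of the quadratic form of
  \<open>P\<close>.\<close>

lemma inner_psd_nonneg:
  assumes "psd P" "psd Q"
  shows "0 \<le> P \<bullet> Q"
proof -
  obtain vs where "Q = sum_list (map outer_prod vs)"
    using psd_imp_sum_outer_prod[OF assms(2)] by blast
  then show ?thesis
    using assms(1) by (auto simp: inner_sum_list_outer_prod psd_def intro!: sum_list_nonneg)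
qed

text \<open>Strict positivity of the form of \<open>P\<close> forces every vector in the rank-one
  decomposition of \<open>Q\<close> to vanish.\<close>

lemma inner_cposdef_psd_eq_0:
  assumes "cposdef P" "psd Q" "P \<bullet> Q = 0"
  shows "Q = 0"
proof -
  obtain vs where vs: "Q = sum_list (map outer_prod vs)"
    using psd_imp_sum_outer_prod[OF assms(2)] by blast
  have P: "0 \<le> v \<bullet> (P *v v)" for v
    using cposdef_imp_psd[OF assms(1)] by (simp add: psd_def)
  have "(\<Sum>v\<leftarrow>vs. v \<bullet> (P *v v)) = 0"
    using assms(3) by (simp add: vs inner_sum_list_outer_prod)
  then have "\<forall>v\<in>set vs. v \<bullet> (P *v v) = 0"
    by (subst (asm) sum_list_nonneg_eq_0_iff) (auto simp: P)
  then have "\<forall>v\<in>set vs. v = 0"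
    using assms(1) by (auto simp: cposdef_alt)
  then have "map outer_prod vs = map (\<lambda>_. 0) vs"
    by (auto simp: outer_prod_def vec_eq_iff)
  then show ?thesis by (simp only: vs sum_list_0)
qed

lemma psd_mat_1: "psd (mat 1)"
  by (simp add: psd_def)

lemma psd_trace_nonneg: "psd P \<Longrightarrow> 0 \<le> mat 1 \<bullet> P"
  by (rule inner_psd_nonneg[OF psd_mat_1])

text \<open>A rank-one term \<open>v v*\<close> has norm at most its trace; the triangle inequality
  and additivity of the trace do the rest.\<close>

lemma psd_norm_le_trace:
  assumes "psd P"
  shows "norm P \<le> mat 1 \<bullet> P"
proof -
  obtain vs where vs: "P = sum_list (map outer_prod vs)"
    using psd_imp_sum_outer_prod[OF assms] by blast
  have norm_op: "norm (outer_prod v) \<le> v \<bullet> v" for v :: "complex^'a"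
  proof -
    have "(norm (outer_prod v))\<^sup>2 = v \<bullet> (outer_prod v *v v)"
      by (simp add: power2_norm_eq_inner inner_outer_prod)
    also have "\<dots> \<le> norm v * (norm (outer_prod v) * norm v)"
      by (rule order_trans[OF norm_cauchy_schwarz mult_left_mono[OF norm_matrix_vector_mult_le]]) simp
    finally have "norm (outer_prod v) * norm (outer_prod v) \<le> (v \<bullet> v) * norm (outer_prod v)"
      by (simp add: power2_norm_eq_inner[symmetric] power2_eq_square algebra_simps)
    then show ?thesis
      by (cases "norm (outer_prod v) = 0") (auto simp: mult_le_cancel_right)
  qed
  have "norm (sum_list (map outer_prod vs)) \<le> (\<Sum>v\<leftarrow>vs. v \<bullet> v)"
    by (induction vs) (auto intro!: order_trans[OF norm_triangle_ineq] add_mono norm_op)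
  then show ?thesis
    by (simp add: vs inner_sum_list_outer_prod)
qed

section \<open>Powers and inverses of positive definite matrices\<close>

lemma mpow_0 [simp]: "mpow M 0 = mat 1"
  by (simp add: mpow_def)

lemma mpow_Suc [simp]: "mpow M (Suc k) = mpow M k ** M"
  by (simp add: mpow_def)

lemma mpow_commute: "mpow M k ** M = M ** mpow M k"
proof (induction k)
  case (Suc k)
  show ?case by (simp only: mpow_Suc matrix_mul_assoc Suc.IH[symmetric])
qed simp

lemma continuous_on_mpow [continuous_intros]:
  fixes F :: "'a::topological_space \<Rightarrow> complex^'n^'n"
  assumes "continuous_on S F"
  shows "continuous_on S (\<lambda>x. mpow (F x) k)"
  by (induction k) (auto intro!: continuous_intros assms)

lemma cposdef_mult_eq_0: "cposdef M \<Longrightarrow> M *v x = 0 \<Longrightarrow> x = 0"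
  unfolding cposdef_alt by (metis inner_zero_right less_irrefl)

lemma cposdef_ctrans_mult:
  assumes "cposdef M" and "\<And>x. A *v x = 0 \<Longrightarrow> x = 0"
  shows "cposdef (ctrans A ** M ** A)"
proof -
  have "x \<bullet> (ctrans A ** M ** A *v x) = (A *v x) \<bullet> (M *v (A *v x))" for x
    by (simp only: inner_matrix_vector_mult matrix_vector_mul_assoc matrix_mul_assoc)
  then show ?thesis
    using assms by (auto simp: cposdef_alt ctrans_matrix_mult matrix_mul_assoc)
qed

lemma cposdef_mat_1: "cposdef (mat 1)"
  by (simp add: cposdef_alt)

lemma mpow_Suc_Suc: "mpow M (Suc (Suc k)) = M ** mpow M k ** M"
  by (simp add: mpow_commute)

text \<open>\<open>M^(k+2)\<close> is the congruence of \<open>M^k\<close> by \<open>M\<close>, so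
  the induction goes in steps of two, from the identity and \<open>M\<close>.\<close>

lemma psd_mpow: "psd M \<Longrightarrow> psd (mpow M k)"
proof (induction k rule: induct_nat_012)
  case (ge2 k)
  then have "psd (ctrans M ** mpow M k ** M)"
    by (intro psd_ctrans_mult) auto
  then show ?case
    using ge2.prems unfolding mpow_Suc_Suc by (simp add: psd_def)
qed (auto simp: psd_mat_1)

lemma cposdef_mpow: "cposdef M \<Longrightarrow> cposdef (mpow M k)"
proof (induction k rule: induct_nat_012)
  case (ge2 k)
  then have "cposdef (ctrans M ** mpow M k ** M)"
    by (intro cposdef_ctrans_mult) (auto intro: cposdef_mult_eq_0)
  then show ?case
    using ge2.prems unfolding mpow_Suc_Suc by (simp add: cposdef_alt)
qed (auto simp: cposdef_mat_1)

lemma matrix_inv_inverse: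
  assumes "invertible M"
  shows "M ** matrix_inv M = mat 1" "matrix_inv M ** M = mat 1"
proof -
  have "M ** matrix_inv M = mat 1 \<and> matrix_inv M ** M = mat 1"
    unfolding matrix_inv_def using assms unfolding invertible_def by (rule someI_ex)
  then show "M ** matrix_inv M = mat 1" "matrix_inv M ** M = mat 1" by auto
qed

lemma invertible_if_trivial_kernel:
  fixes M :: "complex^'n^'n"
  assumes "\<And>x. M *v x = 0 \<Longrightarrow> x = 0"
  shows "invertible M"
  using assms by (simp add: invertible_left_inverse matrix_left_invertible_ker)

lemma cposdef_invertible: "cposdef M \<Longrightarrow> invertible M"
  by (rule invertible_if_trivial_kernel) (rule cposdef_mult_eq_0)

lemma matrix_inv_unique:
  fixes M :: "'a::semiring_1^'n^'n"
  assumes "M ** X = mat 1" "X ** M = mat 1"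
  shows "matrix_inv M = X"
proof -
  have "invertible M" using assms unfolding invertible_def by blast
  then show ?thesis
    by (metis assms(1) matrix_inv_inverse(2) matrix_mul_assoc matrix_mul_lid matrix_mul_rid)
qed

lemma matrix_mult_cancel_invertible:
  fixes A W0 :: "complex^'n^'n"
  assumes "invertible W0" "ctrans W0 ** A ** W0 = 0"
  shows "A = 0"
proof -
  have W0: "W0 ** matrix_inv W0 = mat 1" by (rule matrix_inv_inverse(1)[OF assms(1)])
  have "0 = ctrans (matrix_inv W0) ** (ctrans W0 ** A ** W0) ** matrix_inv W0"
    by (simp add: assms(2))
  also have "\<dots> = ctrans (W0 ** matrix_inv W0) ** A ** (W0 ** matrix_inv W0)"
    by (simp only: ctrans_matrix_mult matrix_mul_assoc)
  finally show ?thesis by (simp add: W0)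
qed

text \<open>Uniqueness of inverses makes the inverse \<open>Y\<close> Hermitian, after which
  \<open>Y = Y* M Y\<close> is a congruence of \<open>M\<close> by an injective matrix.\<close>

lemma cposdef_matrix_inv:
  assumes "cposdef M"
  shows "cposdef (matrix_inv M)"
proof -
  define Y where "Y = matrix_inv M"
  have MY: "M ** Y = mat 1" and YM: "Y ** M = mat 1"
    unfolding Y_def using matrix_inv_inverse cposdef_invertible[OF assms] by auto
  have "M ** ctrans Y = mat 1" "ctrans Y ** M = mat 1"
    using assms arg_cong[OF MY, of ctrans] arg_cong[OF YM, of ctrans]
    by (auto simp: ctrans_matrix_mult cposdef_alt)
  then have herm: "ctrans Y = Y"
    unfolding Y_def by (metis matrix_inv_unique)
  have "x = 0" if "Y *v x = 0" for x
    using MY that by (metis matrix_vector_mul_assoc matrix_vector_mul_lid matrix_vector_mult_0_right)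
  then have "cposdef (ctrans Y ** M ** Y)"
    by (intro cposdef_ctrans_mult assms)
  then show ?thesis
    by (simp add: herm YM Y_def[symmetric])
qed

section \<open>Trace inequalities without spectral calculus\<close>

lemma psd_diff_mult_diff:
  assumes "psd Z" "ctrans X = X" "ctrans Y = Y"
  shows "psd ((X - Y) ** Z ** (X - Y))"
  using psd_ctrans_mult[OF assms(1), of "X - Y"] assms by (simp add: ctrans_linear)

text \<open>\<open>X\<close> commutes with its powers, so a factor \<open>X\<close> on either side
  of the product passes into \<open>mpow X k\<close>; the hypothesis \<open>ZY\<close> merges the
  two cross terms.\<close>

lemma inner_mpow_second_difference:
  assumes X: "ctrans X = X" and ZY: "Z ** Y = Y ** Z"
  shows "mpow X k \<bullet> ((X - Y) ** Z ** (X - Y)) =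
    mpow X (Suc (Suc k)) \<bullet> Z - 2 * (mpow X (Suc k) \<bullet> (Y ** Z)) + mpow X k \<bullet> (Y ** Z ** Y)"
proof -
  have left: "mpow X k \<bullet> (X ** C) = mpow X (Suc k) \<bullet> C" for k C
    using inner_matrix_mult_left[of X "mpow X k" C] X by (simp add: mpow_commute)
  have right: "mpow X k \<bullet> (C ** X) = mpow X (Suc k) \<bullet> C" for k C
    using inner_matrix_mult_right[of "mpow X k" X C] X by simp
  have "(X - Y) ** Z ** (X - Y) = (X ** Z) ** X - X ** (Z ** Y) - (Y ** Z) ** X + Y ** Z ** Y"
    by (simp add: matrix_mult_algebra matrix_mul_assoc)
  also have "mpow X k \<bullet> \<dots> = mpow X (Suc (Suc k)) \<bullet> Z - 2 * (mpow X (Suc k) \<bullet> (Y ** Z))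
      + mpow X k \<bullet> (Y ** Z ** Y)"
    by (simp only: inner_add_right inner_diff_right left right ZY)
  finally show ?thesis .
qed

text \<open>Klein's inequality for the convex function \<open>N \<mapsto> tr N\<^sup>-\<^sup>p\<close> without spectral calculus:
  the numbers \<open>a\<^sub>k = tr (X\<^sup>k Y\<^sup>p\<^sup>-\<^sup>k)\<close>, \<open>0 \<le> k \<le> p + 1\<close>, form a convex sequence, because their second
  differences are \<open>tr (X\<^sup>k (X - Y) Z (X - Y))\<close> with \<open>Z\<close> a power of \<open>Y\<close>.\<close>

lemma trace_inverse_power_tangent:
  fixes N X Y :: "complex^'n^'n"
  assumes X: "cposdef X" and N: "cposdef N" and NY: "N ** Y = mat 1" and YN: "Y ** N = mat 1"
  shows trace_inverse_power_tangent_le: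
      "real (Suc p) * (mat 1 \<bullet> mpow X p) \<le> mat 1 \<bullet> mpow Y p + real p * (mpow X (Suc p) \<bullet> N)"
    and trace_inverse_power_tangent_eq:
      "0 < p \<Longrightarrow> real (Suc p) * (mat 1 \<bullet> mpow X p) = mat 1 \<bullet> mpow Y p + real p * (mpow X (Suc p) \<bullet> N)
        \<Longrightarrow> X = Y"
proof -
  have Y: "cposdef Y"
    using cposdef_matrix_inv[OF N] matrix_inv_unique[OF NY YN] by simp
  have hX: "ctrans X = X" and hY: "ctrans Y = Y"
    using X Y by (auto simp: cposdef_alt)
  \<comment> \<open>\<open>Z k\<close> is the power \<open>Y^(p - k)\<close>; at
    \<open>k = Suc p\<close> the exponent is -1 and the value is \<open>N\<close>.\<close>
  define Z where "Z k = (if k \<le> p then mpow Y (p - k) else N)" for k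
  define a where "a k = mpow X k \<bullet> Z k" for k
  define d where "d k = a k - a (Suc k)" for k
  have Zpsd: "psd (Z k)" for k
    by (simp add: Z_def psd_mpow cposdef_imp_psd Y N)
  have ZSuc: "Y ** Z (Suc k) = Z k" "Z (Suc k) ** Y = Z k" if "k \<le> p" for k
  proof -
    show "Y ** Z (Suc k) = Z k"
    proof (cases "k = p")
      case False
      with that have "k < p" by simp
      then obtain j where "p = Suc (k + j)" using less_imp_Suc_add by blast
      then show ?thesis by (simp add: Z_def mpow_commute)
    qed (simp add: Z_def YN)
    show "Z (Suc k) ** Y = Z k"
    proof (cases "k = p")
      case False
      with that have "k < p" by simp
      then obtain j where "p = Suc (k + j)" using less_imp_Suc_add by blast
      then show ?thesis by (simp add: Z_def)
    qed (simp add: Z_def NY)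
  qed
  have sd: "d k - d (Suc k) = mpow X k \<bullet> ((X - Y) ** Z (Suc (Suc k)) ** (X - Y))" if "k < p" for k
  proof -
    have "mpow X k \<bullet> ((X - Y) ** Z (Suc (Suc k)) ** (X - Y)) =
      mpow X (Suc (Suc k)) \<bullet> Z (Suc (Suc k)) - 2 * (mpow X (Suc k) \<bullet> (Y ** Z (Suc (Suc k))))
        + mpow X k \<bullet> (Y ** Z (Suc (Suc k)) ** Y)"
      by (rule inner_mpow_second_difference[OF hX]) (simp only: ZSuc[OF Suc_leI[OF that]])
    also have "\<dots> = a (Suc (Suc k)) - 2 * a (Suc k) + a k"
      unfolding a_def by (simp only: ZSuc[OF Suc_leI[OF that]] ZSuc[OF less_imp_le[OF that]])
    finally show ?thesis by (simp add: d_def)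
  qed
  have d_anti: "d (Suc k) \<le> d k" if "k < p" for k
    using inner_psd_nonneg[OF psd_mpow[OF cposdef_imp_psd[OF X], of k]
        psd_diff_mult_diff[OF Zpsd[of "Suc (Suc k)"] hX hY]] sd[OF that] by simp
  have d_ge: "d p \<le> d k" if "k \<le> p" for k
    using that
  proof (induction rule: inc_induct)
    case (step n)
    then show ?case using d_anti[of n] by linarith
  qed simp
  have tele: "(\<Sum>k<p. d k) = a 0 - a p"
    by (simp add: d_def sum_lessThan_telescope')
  \<comment> \<open>The two sides differ by the height of \<open>a 0\<close> above the line through
    \<open>a p\<close> and \<open>a (Suc p)\<close>, which is a sum of differences of
    slopes.\<close>
  have gap: "mat 1 \<bullet> mpow Y p + real p * (mpow X (Suc p) \<bullet> N) - real (Suc p) * (mat 1 \<bullet> mpow X p)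
      = (\<Sum>k<p. d k - d p)"
  proof -
    have a0: "a 0 = mat 1 \<bullet> mpow Y p" and ap: "a p = mat 1 \<bullet> mpow X p"
      and aS: "a (Suc p) = mpow X (Suc p) \<bullet> N"
      by (simp_all add: a_def Z_def inner_commute[of _ "mat 1"])
    have "(\<Sum>k<p. d k - d p) = a 0 - a p - real p * d p"
      by (simp add: sum_subtractf tele)
    then show ?thesis
      unfolding d_def a0[symmetric] ap[symmetric] aS[symmetric] by (simp only: of_nat_Suc ring_distribs)
  qed
  have terms: "0 \<le> d k - d p" if "k < p" for k
    using d_ge[of k] that by simp
  show "real (Suc p) * (mat 1 \<bullet> mpow X p) \<le> mat 1 \<bullet> mpow Y p + real p * (mpow X (Suc p) \<bullet> N)"
  proof -
    have "0 \<le> (\<Sum>k<p. d k - d p)" by (rule sum_nonneg) (simp only: lessThan_iff terms)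
    then show ?thesis using gap by linarith
  qed
  assume p: "0 < p"
    and eq: "real (Suc p) * (mat 1 \<bullet> mpow X p) = mat 1 \<bullet> mpow Y p + real p * (mpow X (Suc p) \<bullet> N)"
  have "(\<Sum>k<p. d k - d p) = 0" using gap eq by linarith
  then have "\<forall>k\<in>{..<p}. d k - d p = 0"
    by (subst (asm) sum_nonneg_eq_0_iff) (simp_all only: finite_lessThan lessThan_iff terms)
  \<comment> \<open>The term at \<open>p - 1\<close>, present because \<open>0 < p\<close>, is the
    one whose second difference contains \<open>Z (Suc p) = N\<close>. Definiteness of
    \<open>N\<close> then forces \<open>X = Y\<close>.\<close>
  then have "d (p - 1) - d p = 0"
    using p by simp
  then have "mpow X (p - 1) \<bullet> ((X - Y) ** N ** (X - Y)) = 0"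
    using sd[of "p - 1"] p by (simp add: Z_def del: mpow_Suc)
  then have "(X - Y) ** N ** (X - Y) = 0"
    by (intro inner_cposdef_psd_eq_0[OF cposdef_mpow[OF X]] psd_diff_mult_diff hX hY
        cposdef_imp_psd N)
  moreover have "x \<bullet> ((X - Y) ** N ** (X - Y) *v x) = ((X - Y) *v x) \<bullet> (N *v ((X - Y) *v x))" for x
    by (simp only: inner_matrix_vector_mult matrix_vector_mul_assoc matrix_mul_assoc ctrans_linear hX hY)
  ultimately have "((X - Y) *v x) \<bullet> (N *v ((X - Y) *v x)) = 0" for x by simp
  then have "(X - Y) *v x = 0" for x
    using N unfolding cposdef_alt by (metis less_irrefl)
  then have "X - Y = 0" by (simp add: matrix_eq)
  then show "X = Y" by simp
qed

text \<open>Bernoulli's inequality for traces: the traces of the powers of \<open>Y\<close> form a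
  convex sequence, which lies above its initial tangent. It reduces every exponent \<open>p\<close>
  to the trace of \<open>Y\<close> itself.\<close>

lemma trace_mpow_bernoulli:
  fixes Y :: "complex^'n^'n"
  assumes "cposdef Y"
  shows "real p * (mat 1 \<bullet> Y) - real p * real CARD('n) \<le> mat 1 \<bullet> mpow Y p"
proof -
  define b where "b k = mpow Y k \<bullet> mat 1" for k
  have hY: "ctrans Y = Y" using assms by (simp add: cposdef_alt)
  have cvx: "0 \<le> b (Suc (Suc k)) - 2 * b (Suc k) + b k" for k
    using inner_psd_nonneg[OF psd_mpow[OF cposdef_imp_psd[OF assms], of k]
        psd_diff_mult_diff[OF psd_mat_1 hY ctrans_mat_1]]
      inner_mpow_second_difference[OF hY, of "mat 1" "mat 1" k]
    by (simp add: b_def)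
  have step: "b (Suc k) - b k \<le> b (Suc (Suc k)) - b (Suc k)" for k
    using cvx[of k] by linarith
  have inc: "b 1 - b 0 \<le> b (Suc k) - b k" for k
  proof (induction k)
    case (Suc k)
    then show ?case using step[of k] by linarith
  qed simp
  have "real p * (b 1 - b 0) + b 0 \<le> b p" for p
  proof (induction p)
    case (Suc p)
    then show ?case using inc[of p] by (simp add: algebra_simps)
  qed simp
  from this[of p] have "real p * (b 1 - b 0) + b 0 \<le> b p" .
  moreover have "b 0 = real CARD('n)"
    by (simp add: b_def Re_trace[symmetric] trace_I)
  moreover have "b 1 = mat 1 \<bullet> Y" by (simp add: b_def inner_commute)
  ultimately show ?thesis by (simp add: b_def inner_commute algebra_simps)
qed

text \<open>Completing the square: \<open>tr ((X - Y) N (X - Y))\<close> is nonnegative, and for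
  \<open>Y\<close> the inverse of \<open>N\<close> and \<open>X = x x* / s\<close> it equals
  \<open>tr Y - 1 / s\<close>.\<close>

lemma trace_inverse_ge:
  fixes N :: "complex^'n^'n"
  assumes N: "cposdef N" and x: "norm x = 1"
  shows "1 / (x \<bullet> (N *v x)) \<le> mat 1 \<bullet> matrix_inv N"
proof -
  define Y where "Y = matrix_inv N"
  define s where "s = x \<bullet> (N *v x)"
  define X where "X = (1 / s) *\<^sub>R outer_prod x"
  have s: "0 < s" using N x unfolding s_def cposdef_alt by (metis norm_zero zero_neq_one)
  have NY: "N ** Y = mat 1" and YN: "Y ** N = mat 1"
    unfolding Y_def using matrix_inv_inverse cposdef_invertible[OF N] by auto
  have hY: "ctrans Y = Y" using cposdef_matrix_inv[OF N] by (simp add: cposdef_alt Y_def)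
  have hX: "ctrans X = X" by (simp add: X_def ctrans_linear)
  have oo: "outer_prod x ** outer_prod x = outer_prod x"
  proof -
    have zz: "complex_of_real (z \<bullet> z) = cnj z * z" for z
      by (simp add: complex_eq_iff inner_complex_def)
    have "(\<Sum>k\<in>UNIV. x $ i * cnj (x $ k) * (x $ k * cnj (x $ j)))
        = x $ i * cnj (x $ j) * of_real ((norm x)\<^sup>2)" for i j
      unfolding power2_norm_eq_inner inner_vec_def of_real_sum zz sum_distrib_left
      by (simp add: ac_simps)
    then show ?thesis
      by (simp add: outer_prod_def matrix_matrix_mult_def vec_eq_iff x)
  qed
  have "(X - Y) ** N ** (X - Y) = X ** N ** X - (X + X) + Y"
    by (simp add: matrix_mult_algebra YN)
      (simp add: matrix_mul_assoc[symmetric] NY algebra_simps)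
  moreover have "mat 1 \<bullet> (X ** N ** X) = 1 / s"
  proof -
    have "mat 1 \<bullet> (X ** N ** X) = (X ** X) \<bullet> N"
      using inner_matrix_mult_right[of "X" X N] inner_matrix_mult_left[of X "mat 1" "N ** X"] hX
      by (simp add: matrix_mul_assoc)
    also have "X ** X = (1 / s * (1 / s)) *\<^sub>R outer_prod x"
      by (simp add: X_def matrix_mult_algebra oo)
    finally show ?thesis
      using s by (simp add: inner_outer_prod s_def[symmetric])
  qed
  moreover have "mat 1 \<bullet> X = 1 / s"
    using x by (simp add: X_def inner_commute[of "mat 1"] inner_outer_prod norm_eq_1)
  ultimately have "mat 1 \<bullet> ((X - Y) ** N ** (X - Y)) = mat 1 \<bullet> Y - 1 / s"
    by (simp only: inner_add_right inner_diff_right)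
  then show ?thesis
    using psd_trace_nonneg[OF psd_diff_mult_diff[OF cposdef_imp_psd[OF N] hX hY]]
    by (simp add: s_def Y_def)
qed

section \<open>Lipschitz continuity of the transfer functions\<close>

text \<open>Cramer's rule for the \<open>l\<close>-th unit vector, whose solution is the
  \<open>l\<close>-th column of the inverse. Writing the entries through determinants yields
  continuity of inversion.\<close>

lemma matrix_inv_cramer:
  fixes A :: "'a::field^'n^'n"
  assumes "invertible A"
  shows "matrix_inv A $ k $ l = det (\<chi> i j. if j = k then axis l 1 $ i else A $ i $ j) / det A"
proof -
  have "det A \<noteq> 0" using assms by (simp add: invertible_det_nz)
  moreover have "A *v (matrix_inv A *v axis l 1) = axis l 1"
    by (simp add: matrix_vector_mul_assoc matrix_inv_inverse(1)[OF assms])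
  ultimately have "matrix_inv A *v axis l 1
      = (\<chi> k. det (\<chi> i j. if j = k then axis l 1 $ i else A $ i $ j) / det A)"
    using cramer by blast
  moreover have "(matrix_inv A *v axis l 1) $ k = matrix_inv A $ k $ l"
    by (simp add: matrix_vector_mult_def axis_def if_distrib[of "(*) _"] cong: if_cong)
  ultimately show ?thesis by simp
qed

lemma continuous_on_det:
  fixes F :: "'a::topological_space \<Rightarrow> complex^'n^'n"
  assumes "\<And>i j. continuous_on S (\<lambda>x. F x $ i $ j)"
  shows "continuous_on S (\<lambda>x. det (F x))"
  unfolding det_def by (intro continuous_intros assms)

lemma continuous_on_matrix_inv:
  fixes F :: "'a::topological_space \<Rightarrow> complex^'n^'n"
  assumes F: "continuous_on S F" and inv: "\<And>x. x \<in> S \<Longrightarrow> invertible (F x)"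
  shows "continuous_on S (\<lambda>x. matrix_inv (F x))"
proof -
  have comp: "continuous_on S (\<lambda>x. F x $ i $ j)" for i j
    by (intro continuous_intros F)
  have "continuous_on S (\<lambda>x. det (\<chi> i j. if j = k then axis l 1 $ i else F x $ i $ j) / det (F x))"
    for k l
  proof (intro continuous_on_divide continuous_on_det)
    show "continuous_on S (\<lambda>x. (\<chi> i j. if j = k then axis l 1 $ i else F x $ i $ j) $ i $ j)" for i j
      by (cases "j = k") (simp_all add: comp)
  qed (use comp inv in \<open>auto simp: invertible_det_nz\<close>)
  then have "continuous_on S (\<lambda>x. \<chi> k l. det (\<chi> i j. if j = k then axis l 1 $ i else F x $ i $ j) / det (F x))"
    by (intro continuous_on_vec_lambda)
  then show ?thesis
    by (rule continuous_on_eq) (simp add: vec_eq_iff matrix_inv_cramer inv)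
qed

lemma compact_norm_bound:
  fixes f :: "'a::topological_space \<Rightarrow> 'b::real_normed_vector"
  assumes "compact X" "continuous_on X f"
  shows "\<exists>C\<ge>0. \<forall>x\<in>X. norm (f x) \<le> C"
proof -
  have "bounded (f ` X)"
    using assms by (intro compact_imp_bounded compact_continuous_image)
  then obtain B where "\<forall>y\<in>f ` X. norm y \<le> B" by (auto simp: bounded_iff)
  then show ?thesis
    by (intro exI[of _ "max B 0"]) force
qed

text \<open>Compactness bounds both factors, and the increment splits into one in \<open>f\<close>
  and one in \<open>g\<close>.\<close>

lemma lipschitz_on_bounded_bilinear:
  assumes h: "bounded_bilinear h" and X: "compact X"
    and f: "\<exists>L. L-lipschitz_on X f" and g: "\<exists>L. L-lipschitz_on X g"
  shows "\<exists>L. L-lipschitz_on X (\<lambda>x. h (f x) (g x))"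
proof -
  interpret bounded_bilinear h by fact
  obtain K where K: "0 < K" "\<And>a b. norm (h a b) \<le> norm a * norm b * K"
    using pos_bounded by blast
  obtain Lf Lg where L: "Lf-lipschitz_on X f" "Lg-lipschitz_on X g" using f g by blast
  obtain Cf where Cf: "0 \<le> Cf" "\<forall>x\<in>X. norm (f x) \<le> Cf"
    using compact_norm_bound[OF X lipschitz_on_continuous_on[OF L(1)]] by blast
  obtain Cg where Cg: "0 \<le> Cg" "\<forall>x\<in>X. norm (g x) \<le> Cg"
    using compact_norm_bound[OF X lipschitz_on_continuous_on[OF L(2)]] by blast
  have L0: "0 \<le> Lf" "0 \<le> Lg" using L by (auto dest: lipschitz_on_nonneg)
  have "((Lf * Cg + Cf * Lg) * K)-lipschitz_on X (\<lambda>x. h (f x) (g x))"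
  proof (rule lipschitz_onI)
    fix x y assume xy: "x \<in> X" "y \<in> X"
    have "norm (h (f x) (g x) - h (f y) (g y)) = norm (h (f x - f y) (g x) + h (f y) (g x - g y))"
      by (simp add: diff_left diff_right)
    also have "\<dots> \<le> norm (f x - f y) * norm (g x) * K + norm (f y) * norm (g x - g y) * K"
      by (intro order_trans[OF norm_triangle_ineq] add_mono K)
    also have "\<dots> \<le> (Lf * dist x y) * Cg * K + Cf * (Lg * dist x y) * K"
      using xy L L0 K(1) Cf Cg by (intro add_mono mult_mono)
        (auto simp: dist_norm[symmetric] dest: lipschitz_onD intro!: mult_nonneg_nonneg)
    finally show "dist (h (f x) (g x)) (h (f y) (g y)) \<le> (Lf * Cg + Cf * Lg) * K * dist x y"
      by (simp add: dist_norm algebra_simps)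
  qed (use L0 Cf Cg K in auto)
  then show ?thesis by blast
qed

lemma lipschitz_on_inverse:
  fixes f :: "'a::metric_space \<Rightarrow> complex"
  assumes X: "compact X" and f: "\<exists>L. L-lipschitz_on X f" and nz: "\<And>x. x \<in> X \<Longrightarrow> f x \<noteq> 0"
  shows "\<exists>L. L-lipschitz_on X (\<lambda>x. inverse (f x))"
proof -
  obtain L where L: "L-lipschitz_on X f" using f by blast
  have "continuous_on X (\<lambda>x. inverse (f x))"
    by (intro continuous_on_inverse lipschitz_on_continuous_on[OF L]) (use nz in blast)
  from compact_norm_bound[OF X this]
  obtain C where C: "0 \<le> C" "\<forall>x\<in>X. norm (inverse (f x)) \<le> C"
    by blast
  have "(C * L * C)-lipschitz_on X (\<lambda>x. inverse (f x))"
  proof (rule lipschitz_onI)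
    fix x y assume xy: "x \<in> X" "y \<in> X"
    have "norm (inverse (f x) - inverse (f y))
        = norm (inverse (f x)) * norm (f x - f y) * norm (inverse (f y))"
      using nz[OF xy(1)] nz[OF xy(2)] by (simp only: inverse_diff_inverse norm_minus_cancel norm_mult not_False_eq_True)
    also have "\<dots> \<le> C * (L * dist x y) * C"
      using xy C L lipschitz_on_nonneg[OF L] by (intro mult_mono)
        (auto simp: dist_norm[symmetric] dest: lipschitz_onD intro!: mult_nonneg_nonneg)
    finally show "dist (inverse (f x)) (inverse (f y)) \<le> C * L * C * dist x y"
      by (simp add: dist_norm algebra_simps)
  qed (use C lipschitz_on_nonneg[OF L] in auto)
  then show ?thesis by blast
qed

lemma lipschitz_on_vec:
  fixes F :: "'a::metric_space \<Rightarrow> 'b::metric_space^'n"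
  assumes "\<And>i. \<exists>L. L-lipschitz_on X (\<lambda>x. F x $ i)"
  shows "\<exists>L. L-lipschitz_on X F"
proof -
  obtain L where L: "\<And>i. (L i)-lipschitz_on X (\<lambda>x. F x $ i)" using assms by metis
  have "(\<Sum>i\<in>UNIV. L i)-lipschitz_on X F"
  proof (rule lipschitz_onI)
    fix x y assume xy: "x \<in> X" "y \<in> X"
    have "dist (F x) (F y) \<le> (\<Sum>i\<in>UNIV. dist (F x $ i) (F y $ i))"
      unfolding dist_vec_def by (rule L2_set_le_sum) simp
    also have "\<dots> \<le> (\<Sum>i\<in>UNIV. L i * dist x y)"
      using L xy by (intro sum_mono) (rule lipschitz_onD)
    finally show "dist (F x) (F y) \<le> (\<Sum>i\<in>UNIV. L i) * dist x y"
      by (simp add: sum_distrib_right)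
  qed (use L in \<open>auto intro!: sum_nonneg dest: lipschitz_on_nonneg\<close>)
  then show ?thesis by blast
qed

lemma compact_circ: "compact circ"
  by (simp add: circ_def)

lemma cis_in_circ [simp]: "cis \<theta> \<in> circ"
  by (simp add: circ_def)

lemma circ_cisE:
  assumes "z \<in> circ"
  obtains \<theta> where "\<theta> \<in> {-pi..pi}" "z = cis \<theta>"
proof
  show "Arg z \<in> {-pi..pi}" using Arg_bounded[of z] by auto
  show "z = cis (Arg z)"
    using assms cis_Arg[of z] by (cases "z = 0") (auto simp: circ_def sgn_div_norm)
qed

text \<open>The chord has length \<open>2 |sin ((a - b) / 2)|\<close>, which is at most the length
  of the arc.\<close>

lemma dist_cis_le: "norm (cis a - cis b) \<le> \<bar>a - b\<bar>"
proof -
  have "(norm (cis a - cis b))\<^sup>2 = (cos a - cos b)\<^sup>2 + (sin a - sin b)\<^sup>2"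
    by (simp add: cmod_power2)
  also have "\<dots> = ((cos a)\<^sup>2 + (sin a)\<^sup>2) + ((cos b)\<^sup>2 + (sin b)\<^sup>2) - 2 * cos (a - b)"
    by (simp add: cos_diff power2_eq_square algebra_simps)
  also have "\<dots> = 2 - 2 * cos (2 * ((a - b) / 2))"
    by (simp only: cos_squared_eq nonzero_mult_div_cancel_left times_divide_eq_right)
  also have "\<dots> = (2 * sin ((a - b) / 2))\<^sup>2"
    by (simp only: cos_double_sin) (simp add: power2_eq_square)
  also have "\<dots> \<le> \<bar>a - b\<bar>\<^sup>2"
    using abs_sin_x_le_abs_x[of "(a - b) / 2"]
    by (subst abs_le_square_iff[symmetric]) (simp add: abs_mult)
  finally show ?thesis by (rule power2_le_imp_le) simp
qed

lemma lipschitz_on_poly: "\<exists>L. L-lipschitz_on circ (poly p)" for p :: "complex poly"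
proof (induction p)
  case 0
  then show ?case using lipschitz_on_constant by (auto simp: poly_0)
next
  case (pCons a p)
  have "\<exists>L. L-lipschitz_on circ (\<lambda>z. z * poly p z)"
    by (rule lipschitz_on_bounded_bilinear[OF bounded_bilinear_mult compact_circ])
      (use pCons lipschitz_on_id in auto)
  then obtain L where "L-lipschitz_on circ (\<lambda>z. z * poly p z)" by blast
  then have "(0 + L)-lipschitz_on circ (\<lambda>z. a + z * poly p z)"
    by (intro lipschitz_on_add lipschitz_on_constant)
  then show ?case by (auto simp: fun_eq_iff[of "poly (pCons a p)"] cong: lipschitz_on_cong)
qed

lemma lipschitz_on_rational:
  fixes p q :: "complex poly"
  assumes "\<And>z. z \<in> circ \<Longrightarrow> poly q z \<noteq> 0"
  shows "\<exists>L. L-lipschitz_on circ (\<lambda>z. poly p z / poly q z)"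
  unfolding divide_inverse
  by (intro lipschitz_on_bounded_bilinear[OF bounded_bilinear_mult] compact_circ lipschitz_on_poly
      lipschitz_on_inverse assms)

text \<open>Every entry is a quotient of polynomials whose denominator vanishes only in the open
  disk, hence nowhere on the circle.\<close>

lemma lipschitz_on_canonical_left_factor:
  fixes W \<Psi> :: "complex \<Rightarrow> ((complex, 'm::{finite,linorder}) vec, 'm) vec"
  assumes "canonical_left_factor W \<Psi>"
  shows "\<exists>L. L-lipschitz_on circ W"
proof (intro lipschitz_on_vec)
  fix i j
  obtain p q :: "complex poly" where pq: "\<forall>z. poly q z = 0 \<longrightarrow> cmod z < 1"
    "\<forall>z. 1 \<le> cmod z \<longrightarrow> W z $ i $ j = poly p z / poly q z"
    using assms unfolding canonical_left_factor_def by blast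
  then have "\<exists>L. L-lipschitz_on circ (\<lambda>z. poly p z / poly q z)"
    by (intro lipschitz_on_rational) (auto simp: circ_def)
  moreover have "W z $ i $ j = poly p z / poly q z" if "z \<in> circ" for z
    using pq(2) that by (simp add: circ_def)
  ultimately show "\<exists>L. L-lipschitz_on circ (\<lambda>z. W z $ i $ j)"
    by (simp cong: lipschitz_on_cong)
qed

lemma mat_vector_mult: "mat c *v x = c *s x"
  by (simp add: vec_eq_iff matrix_vector_mult_def mat_def if_distrib[of "\<lambda>y. y * _"] cong: if_cong)

lemma stable_resolvent_invertible:
  assumes "stable A" "1 \<le> cmod z"
  shows "invertible (mat z - cmat A)"
proof (rule invertible_if_trivial_kernel, rule ccontr)
  fix x assume "(mat z - cmat A) *v x = 0" "x \<noteq> 0"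
  then have "cmat A *v x = z *s x"
    by (simp add: matrix_vector_mult_diff_rdistrib mat_vector_mult)
  then have "cmod z < 1"
    using assms(1) \<open>x \<noteq> 0\<close> unfolding stable_def by blast
  then show False using assms(2) by simp
qed

text \<open>The resolvent identity \<open>R z - R w = R z (w - z) R w\<close>, together with a
  uniform bound of \<open>R\<close> on the circle that comes from continuity.\<close>

lemma lipschitz_on_resolvent:
  assumes "stable A"
  shows "\<exists>L. L-lipschitz_on circ (\<lambda>z. matrix_inv (mat z - cmat A))"
proof -
  define R where "R z = matrix_inv (mat z - cmat A)" for z
  have inv: "invertible (mat z - cmat A)" if "z \<in> circ" for z
    using that by (intro stable_resolvent_invertible assms) (simp add: circ_def)
  have "continuous_on circ (\<lambda>z. mat z - cmat A)"
    unfolding mat_def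
  proof (intro continuous_intros)
    show "continuous_on circ (\<lambda>z. if i = j then z else 0)" for i j :: 'a
      by (cases "i = j") simp_all
  qed
  then have "continuous_on circ R"
    unfolding R_def by (intro continuous_on_matrix_inv inv)
  from compact_norm_bound[OF compact_circ this]
  obtain C where C: "0 \<le> C" "\<forall>z\<in>circ. norm (R z) \<le> C" by blast
  have "(C * C * norm (mat 1 :: complex^'a^'a))-lipschitz_on circ R"
  proof (rule lipschitz_onI)
    fix z w assume zw: "z \<in> circ" "w \<in> circ"
    define D :: "complex^'a^'a" where "D = mat w - mat z"
    have D: "D = (mat w - cmat A) - (mat z - cmat A)" by (simp add: D_def)
    have "R z ** D ** R w = R z ** ((mat w - cmat A) ** R w) - (R z ** (mat z - cmat A)) ** R w"
      unfolding D by (simp only: matrix_mult_algebra matrix_mul_assoc)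
    also have "\<dots> = R z - R w"
      unfolding R_def by (simp add: matrix_inv_inverse inv zw)
    finally have "norm (R z - R w) = norm (R z ** D ** R w)" by simp
    also have "\<dots> \<le> norm (R z) * norm D * norm (R w)"
      by (rule order_trans[OF norm_matrix_matrix_mult_le mult_right_mono[OF norm_matrix_matrix_mult_le]]) simp
    also have "\<dots> \<le> C * norm D * C"
      using C zw by (intro mult_mono) auto
    also have "norm D = norm (w - z) * norm (mat 1 :: complex^'a^'a)"
    proof -
      have "D $ i = (w - z) *s (mat 1 $ i)" for i
        by (simp add: D_def vec_eq_iff mat_def)
      moreover have "norm (c *s v) = norm c * norm v" for c and v :: "complex^'a"
        by (simp add: norm_vec_def norm_mult L2_set_right_distrib)
      ultimately show ?thesis
        by (simp only: norm_vec_def[of D] norm_vec_def[of "mat 1 :: complex^'a^'a"]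
            L2_set_right_distrib norm_ge_zero)
    qed
    finally show "dist (R z) (R w) \<le> C * C * norm (mat 1 :: complex^'a^'a) * dist z w"
      by (simp add: dist_norm norm_minus_commute algebra_simps)
  qed (use C in auto)
  then show ?thesis unfolding R_def by blast
qed

lemma ex_lipschitz_on_const: "\<exists>L. L-lipschitz_on X (\<lambda>_. c)"
  using lipschitz_on_constant by blast

lemma lipschitz_on_Gfun:
  assumes "stable A"
  shows "\<exists>L. L-lipschitz_on circ (Gfun Sig A B)"
  unfolding Gfun_def
  by (intro lipschitz_on_bounded_bilinear[OF bounded_bilinear_matrix_matrix_mult] compact_circ
      lipschitz_on_resolvent assms ex_lipschitz_on_const)

section \<open>Integration over the circle\<close>

definition cintegrable :: "(complex \<Rightarrow> 'a::real_normed_vector) \<Rightarrow> bool" where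
  "cintegrable f \<longleftrightarrow> (\<lambda>\<theta>. f (cis \<theta>)) integrable_on {-pi..pi}"

lemma continuous_on_compose_cis:
  "continuous_on circ f \<Longrightarrow> continuous_on S (\<lambda>\<theta>. f (cis \<theta>))"
  by (rule continuous_on_compose2[of circ f]) (auto intro!: continuous_intros)

lemma cintegrable_continuous:
  fixes f :: "complex \<Rightarrow> 'a::banach"
  shows "continuous_on circ f \<Longrightarrow> cintegrable f"
  unfolding cintegrable_def by (intro integrable_continuous_real continuous_on_compose_cis)

lemma cint_cong: "(\<And>z. z \<in> circ \<Longrightarrow> f z = g z) \<Longrightarrow> cint f = cint g"
  by (simp add: cint_def)

lemma cint_add: "cintegrable f \<Longrightarrow> cintegrable g \<Longrightarrow> cint (\<lambda>z. f z + g z) = cint f + cint g"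
  by (simp add: cint_def cintegrable_def integral_add scaleR_add_right)

lemma cint_diff: "cintegrable f \<Longrightarrow> cintegrable g \<Longrightarrow> cint (\<lambda>z. f z - g z) = cint f - cint g"
  by (simp add: cint_def cintegrable_def integral_diff scaleR_diff_right)

lemma cintegrable_bounded_linear: "bounded_linear h \<Longrightarrow> cintegrable f \<Longrightarrow> cintegrable (\<lambda>z. h (f z))"
  unfolding cintegrable_def using integrable_linear[of "\<lambda>\<theta>. f (cis \<theta>)" "{-pi..pi}" h]
  by (simp add: o_def)

lemma cint_bounded_linear:
  assumes "bounded_linear h" "cintegrable f"
  shows "cint (\<lambda>z. h (f z)) = h (cint f)"
  using integral_linear[of "\<lambda>\<theta>. f (cis \<theta>)" "{-pi..pi}" h] assms
  by (simp add: cint_def cintegrable_def o_def linear_scale[OF bounded_linear.linear[OF assms(1)]])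

lemma cint_const: "cint (\<lambda>_. c) = (c :: 'a::banach)"
  by (simp add: cint_def)

lemma cint_mult_left: "cintegrable f \<Longrightarrow> cint (\<lambda>z. c * f z) = c * cint f" for c :: real
  by (rule cint_bounded_linear[OF bounded_linear_mult_right])

lemma cint_mono:
  fixes f g :: "complex \<Rightarrow> real"
  assumes "cintegrable f" "cintegrable g" "\<And>z. z \<in> circ \<Longrightarrow> f z \<le> g z"
  shows "cint f \<le> cint g"
  using assms by (auto simp: cint_def cintegrable_def intro!: divide_right_mono integral_le)

lemma cint_nonneg:
  fixes f :: "complex \<Rightarrow> real"
  assumes "cintegrable f" "\<And>z. z \<in> circ \<Longrightarrow> 0 \<le> f z"
  shows "0 \<le> cint f"
  using assms
  by (auto simp: cint_def cintegrable_def intro!: divide_nonneg_nonneg integral_nonneg)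

lemma cint_eq_0_imp:
  fixes f :: "complex \<Rightarrow> real"
  assumes "continuous_on circ f" "\<And>z. z \<in> circ \<Longrightarrow> 0 \<le> f z" "cint f = 0" "z \<in> circ"
  shows "f z = 0"
proof -
  have "integral {-pi..pi} (\<lambda>\<theta>. f (cis \<theta>)) = 0"
    using assms(3) by (simp add: cint_def)
  then have "\<forall>\<theta>\<in>{-pi..pi}. f (cis \<theta>) = 0"
    using integral_eq_0_iff[of "-pi" pi "\<lambda>\<theta>. f (cis \<theta>)"] continuous_on_compose_cis[OF assms(1)] assms(2)
    by simp
  then show ?thesis using circ_cisE[OF assms(4)] by metis
qed

lemma continuous_on_cint:
  fixes f :: "'a::topological_space \<Rightarrow> complex \<Rightarrow> 'b::banach"
  assumes "continuous_on (U \<times> circ) (\<lambda>(x, z). f x z)"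
  shows "continuous_on U (\<lambda>x. cint (f x))"
proof -
  have "continuous_on (U \<times> cbox (-pi) pi) (\<lambda>(x, \<theta>). f x (cis \<theta>))"
    unfolding case_prod_beta
    by (rule continuous_on_compose2[OF assms, of _ "\<lambda>y. (fst y, cis (snd y))", unfolded case_prod_beta, simplified])
      (auto intro!: continuous_intros)
  then have "continuous_on U (\<lambda>x. integral (cbox (-pi) pi) (\<lambda>\<theta>. f x (cis \<theta>)))"
    by (rule integral_continuous_on_param)
  then show ?thesis
    unfolding cint_def by (intro continuous_intros) simp
qed

lemma lebesgue_measurable_continuous:
  fixes f :: "real \<Rightarrow> 'b::topological_space"
  shows "continuous_on UNIV f \<Longrightarrow> f \<in> borel_measurable lebesgue"
  by (intro measurable_completion) (simp add: borel_measurable_continuous_onI)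

text \<open>Passes from the Lebesgue measurability in \<open>Splus\<close> to the gauge integral
  behind \<open>cint\<close>: a constant dominates on a bounded interval.\<close>

lemma cintegrable_bounded_measurable:
  fixes f :: "complex \<Rightarrow> 'b::euclidean_space"
  assumes "(\<lambda>\<theta>. f (cis \<theta>)) \<in> borel_measurable lebesgue" "\<And>z. z \<in> circ \<Longrightarrow> norm (f z) \<le> C"
  shows "cintegrable f"
  unfolding cintegrable_def
proof (rule measurable_bounded_by_integrable_imp_integrable)
  show "(\<lambda>\<theta>. f (cis \<theta>)) \<in> borel_measurable (lebesgue_on {-pi..pi})"
    using assms(1) by (rule measurable_restrict_space1)
  show "(\<lambda>_. C) integrable_on {-pi..pi}" by (rule integrable_const_ivl)
qed (use assms(2) in auto)

lemma cintegrable_sandwich: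
  fixes G :: "complex \<Rightarrow> complex^'m^'n"
  assumes G: "continuous_on circ G"
    and meas: "(\<lambda>\<theta>. \<Phi> (cis \<theta>)) \<in> borel_measurable lebesgue"
    and bound: "\<And>z. z \<in> circ \<Longrightarrow> norm (\<Phi> z) \<le> C"
  shows "cintegrable (\<lambda>z. G z ** \<Phi> z ** ctrans (G z))"
proof -
  obtain D where D: "0 \<le> D" "\<forall>z\<in>circ. norm (G z) \<le> D"
    using compact_norm_bound[OF compact_circ G] by blast
  have G_meas: "(\<lambda>\<theta>. G (cis \<theta>)) \<in> borel_measurable lebesgue"
    by (intro lebesgue_measurable_continuous continuous_on_compose_cis G)
  show ?thesis
  proof (rule cintegrable_bounded_measurable)
    show "(\<lambda>\<theta>. G (cis \<theta>) ** \<Phi> (cis \<theta>) ** ctrans (G (cis \<theta>))) \<in> borel_measurable lebesgue"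
      by (rule borel_measurable_continuous_Pair[OF G_meas meas, of "\<lambda>g f. g ** f ** ctrans g"])
        (intro continuous_intros)
    fix z assume z: "z \<in> circ"
    have "norm (G z ** \<Phi> z ** ctrans (G z)) \<le> norm (G z) * norm (\<Phi> z) * norm (G z)"
      using order_trans[OF norm_matrix_matrix_mult_le mult_right_mono[OF norm_matrix_matrix_mult_le norm_ge_zero],
          of "G z" "\<Phi> z" "ctrans (G z)"] by simp
    also have "\<dots> \<le> D * C * D"
      using D bound[OF z] z order_trans[OF norm_ge_zero bound[OF z]] by (intro mult_mono) auto
    finally show "norm (G z ** \<Phi> z ** ctrans (G z)) \<le> D * C * D" .
  qed
qed

lemma cintegrable_sandwich_Splus:
  assumes "continuous_on circ G" "\<Phi> \<in> Splus"
  shows "cintegrable (\<lambda>z. G z ** \<Phi> z ** ctrans (G z))"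
proof -
  obtain C where "\<forall>z\<in>circ. norm (\<Phi> z) \<le> C" using assms(2) by (auto simp: Splus_def)
  then show ?thesis
    using assms by (intro cintegrable_sandwich[where C=C]) (auto simp: Splus_def)
qed

lemma inner_cint_sandwich:
  assumes "cintegrable (\<lambda>z. G z ** \<Phi> z ** ctrans (G z))"
  shows "\<Lambda> \<bullet> cint (\<lambda>z. G z ** \<Phi> z ** ctrans (G z)) = cint (\<lambda>z. (ctrans (G z) ** \<Lambda> ** G z) \<bullet> \<Phi> z)"
    and "cintegrable (\<lambda>z. (ctrans (G z) ** \<Lambda> ** G z) \<bullet> \<Phi> z)"
proof -
  have eq: "\<Lambda> \<bullet> (G z ** \<Phi> z ** ctrans (G z)) = (ctrans (G z) ** \<Lambda> ** G z) \<bullet> \<Phi> z" for z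
    using inner_matrix_mult_left[of "ctrans (G z)" "\<Lambda> ** G z" "\<Phi> z"]
      inner_matrix_mult_right[of \<Lambda> "G z" "G z ** \<Phi> z"]
    by (simp add: matrix_mul_assoc)
  show "\<Lambda> \<bullet> cint (\<lambda>z. G z ** \<Phi> z ** ctrans (G z)) = cint (\<lambda>z. (ctrans (G z) ** \<Lambda> ** G z) \<bullet> \<Phi> z)"
    using cint_bounded_linear[OF bounded_linear_inner_right assms, of \<Lambda>] by (simp add: eq)
  show "cintegrable (\<lambda>z. (ctrans (G z) ** \<Lambda> ** G z) \<bullet> \<Phi> z)"
    using cintegrable_bounded_linear[OF bounded_linear_inner_right assms, of \<Lambda>] by (simp add: eq)
qed

lemma quadratic_form_ge_if_unit:
  fixes A :: "complex^'n^'n"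
  assumes unit: "\<And>u. norm u = 1 \<Longrightarrow> c \<le> u \<bullet> (A *v u)"
  shows "c * (norm x)\<^sup>2 \<le> x \<bullet> (A *v x)"
proof (cases "x = 0")
  case False
  define u where "u = (1 / norm x) *\<^sub>R x"
  have "norm u = 1" using False by (simp add: u_def)
  then have "c * (norm x)\<^sup>2 \<le> (u \<bullet> (A *v u)) * (norm x)\<^sup>2"
    by (intro mult_right_mono unit) simp_all
  also have "\<dots> = (norm x *\<^sub>R u) \<bullet> (A *v (norm x *\<^sub>R u))"
    by (simp only: matrix_vector_mult_algebra inner_scaleR_left inner_scaleR_right power2_eq_square
        mult.assoc mult.commute mult.left_commute)
  also have "norm x *\<^sub>R u = x" using False by (simp add: u_def)
  finally show ?thesis .
qed simp

text \<open>The coercivity constant is the minimum of the quadratic form over the compact product of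
  the circle and the unit sphere.\<close>

lemma continuous_cposdef_in_Splus:
  fixes F :: "complex \<Rightarrow> complex^'m^'m"
  assumes cont: "continuous_on circ F" and pd: "\<And>z. z \<in> circ \<Longrightarrow> cposdef (F z)"
  shows "F \<in> Splus"
proof -
  obtain C where C: "0 \<le> C" "\<forall>z\<in>circ. norm (F z) \<le> C"
    using compact_norm_bound[OF compact_circ cont] by auto
  define S where "S = circ \<times> (sphere 0 1 :: (complex^'m) set)"
  define q where "q y = snd y \<bullet> (F (fst y) *v snd y)" for y
  have "compact S" unfolding S_def by (intro compact_Times compact_circ compact_sphere)
  moreover have "S \<noteq> {}"
  proof -
    obtain x :: "complex^'m" where "norm x = 1" using vector_choose_size[of 1] by auto
    then have "(cis 0, x) \<in> S" unfolding S_def by (simp add: mem_Times_iff circ_def)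
    then show ?thesis by blast
  qed
  moreover have "continuous_on S q"
    unfolding q_def S_def
    by (intro continuous_intros continuous_on_compose2[OF cont]) auto
  ultimately have "\<exists>y\<in>S. \<forall>y'\<in>S. q y \<le> q y'"
    by (rule continuous_attains_inf)
  then obtain y where y: "y \<in> S" "\<forall>y'\<in>S. q y \<le> q y'" by auto
  have "snd y \<noteq> 0" "fst y \<in> circ" using y(1) by (auto simp: S_def)
  then have q_pos: "0 < q y"
    using pd[of "fst y"] by (auto simp: q_def cposdef_alt)
  have q_le: "q y * (norm x)\<^sup>2 \<le> x \<bullet> (F z *v x)" if z: "z \<in> circ" for z x
  proof (rule quadratic_form_ge_if_unit)
    fix u :: "complex^'m" assume "norm u = 1"
    then show "q y \<le> u \<bullet> (F z *v u)"
      using bspec[OF y(2), of "(z, u)"] z by (simp add: q_def S_def)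
  qed
  have "(\<lambda>\<theta>. F (cis \<theta>)) \<in> borel_measurable lebesgue"
    by (intro lebesgue_measurable_continuous continuous_on_compose_cis cont)
  moreover have "\<forall>z\<in>circ. ctrans (F z) = F z" using pd by (auto simp: cposdef_alt)
  moreover have "\<exists>\<epsilon>>0. \<forall>z\<in>circ. \<forall>x. \<epsilon> * (norm x)\<^sup>2 \<le> x \<bullet> (F z *v x)"
    by (rule exI[of _ "q y"]) (use q_pos q_le in blast)
  ultimately show ?thesis
    using C unfolding Splus_def Re_cqform by blast
qed

text \<open>Quantifies the logarithmic divergence as \<open>s\<close> tends to 0, on which the
  barrier argument rests.\<close>

lemma integral_inverse_abs_ge:
  fixes s L \<theta>0 :: real
  assumes s: "0 < s" and L: "0 < L" and \<theta>0: "\<theta>0 \<in> {-pi..pi}"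
  shows "(ln (s + L * pi) - ln s) / L \<le> integral {-pi..pi} (\<lambda>\<theta>. 1 / (s + L * \<bar>\<theta> - \<theta>0\<bar>))"
proof -
  define f where "f \<theta> = 1 / (s + L * \<bar>\<theta> - \<theta>0\<bar>)" for \<theta>
  have pos: "0 < s + L * \<bar>\<theta> - \<theta>0\<bar>" for \<theta>
    using s L by (intro add_pos_nonneg) auto
  have cont: "continuous_on S f" for S
    unfolding f_def using pos by (intro continuous_intros) (auto simp: less_imp_neq[symmetric])
  \<comment> \<open>An interval of length \<open>pi\<close> that starts or ends at
    \<open>\<theta>0\<close> fits into \<open>{-pi..pi}\<close>; on it the absolute value resolves
    and \<open>ln\<close> provides an antiderivative.\<close>
  obtain a b where ab: "a \<le> b" "{a..b} \<subseteq> {-pi..pi}"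
    and int: "(f has_integral (ln (s + L * pi) - ln s) / L) {a..b}"
  proof (cases "\<theta>0 \<le> 0")
    case True
    have "(f has_integral ln (s + L * (\<theta>0 + pi - \<theta>0)) / L - ln (s + L * (\<theta>0 - \<theta>0)) / L) {\<theta>0..\<theta>0 + pi}"
    proof (rule fundamental_theorem_of_calculus)
      fix \<theta> assume \<theta>: "\<theta> \<in> {\<theta>0..\<theta>0 + pi}"
      then have p: "0 < s + L * (\<theta> - \<theta>0)" using pos[of \<theta>] by simp
      have "((\<lambda>\<theta>. ln (s + L * (\<theta> - \<theta>0)) / L) has_real_derivative L / (s + L * (\<theta> - \<theta>0)) / L) (at \<theta>)"
        using p by (auto intro!: derivative_eq_intros)
      moreover have "L / (s + L * (\<theta> - \<theta>0)) / L = f \<theta>"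
        using L \<theta> by (simp add: f_def)
      ultimately have "((\<lambda>\<theta>. ln (s + L * (\<theta> - \<theta>0)) / L) has_real_derivative f \<theta>) (at \<theta>)"
        by simp
      then show "((\<lambda>\<theta>. ln (s + L * (\<theta> - \<theta>0)) / L) has_vector_derivative f \<theta>) (at \<theta> within {\<theta>0..\<theta>0 + pi})"
        by (simp add: has_real_derivative_iff_has_vector_derivative has_vector_derivative_at_within)
    qed simp
    then show ?thesis
      using that[of \<theta>0 "\<theta>0 + pi"] True \<theta>0 by (simp add: diff_divide_distrib)
  next
    case False
    have "(f has_integral - ln (s + L * (\<theta>0 - \<theta>0)) / L - - ln (s + L * (\<theta>0 - (\<theta>0 - pi))) / L) {\<theta>0 - pi..\<theta>0}"
    proof (rule fundamental_theorem_of_calculus)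
      fix \<theta> assume \<theta>: "\<theta> \<in> {\<theta>0 - pi..\<theta>0}"
      then have p: "0 < s + L * (\<theta>0 - \<theta>)" using pos[of \<theta>] by simp
      have "((\<lambda>\<theta>. - ln (s + L * (\<theta>0 - \<theta>)) / L) has_real_derivative L / (s + L * (\<theta>0 - \<theta>)) / L) (at \<theta>)"
        using p by (auto intro!: derivative_eq_intros)
      moreover have "L / (s + L * (\<theta>0 - \<theta>)) / L = f \<theta>"
        using L \<theta> by (simp add: f_def)
      ultimately have "((\<lambda>\<theta>. - ln (s + L * (\<theta>0 - \<theta>)) / L) has_real_derivative f \<theta>) (at \<theta>)"
        by simp
      then show "((\<lambda>\<theta>. - ln (s + L * (\<theta>0 - \<theta>)) / L) has_vector_derivative f \<theta>) (at \<theta> within {\<theta>0 - pi..\<theta>0})"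
        by (simp add: has_real_derivative_iff_has_vector_derivative has_vector_derivative_at_within)
    qed simp
    then show ?thesis
      using that[of "\<theta>0 - pi" \<theta>0] False \<theta>0 by (simp add: diff_divide_distrib)
  qed
  have "integral {a..b} f \<le> integral {-pi..pi} f"
    using ab int pos by (intro integral_subset_le integrable_continuous_real cont)
      (auto simp: f_def less_imp_le)
  then have "(ln (s + L * pi) - ln s) / L \<le> integral {-pi..pi} f"
    by (simp only: integral_unique[OF int])
  then show ?thesis by (simp only: f_def[abs_def])
qed

section \<open>The dual problem\<close>

text \<open>Isolates the analytic properties behind the optimization: Lipschitz continuity feeds the
  barrier argument, invertibility of \<open>W\<close> lets \<open>M\<close> determine
  \<open>G* \<Lambda> G\<close>, and feasibility bounds the superlevel sets.\<close>

locale dual_problem =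
  fixes \<nu> :: nat and G :: "complex \<Rightarrow> complex^'m^'n" and W :: "complex \<Rightarrow> complex^'m^'m"
  assumes nu: "1 < \<nu>"
    and G_lipschitz: "\<exists>L. L-lipschitz_on circ G"
    and W_lipschitz: "\<exists>L. L-lipschitz_on circ W"
    and W_invertible: "z \<in> circ \<Longrightarrow> invertible (W z)"
    and feasible: "\<exists>\<Phi>\<in>Splus. cint (\<lambda>z. G z ** \<Phi> z ** ctrans (G z)) = mat 1"
begin

definition moment :: "(complex \<Rightarrow> complex^'m^'m) \<Rightarrow> complex^'n^'n" where
  "moment \<Phi> = cint (\<lambda>z. G z ** \<Phi> z ** ctrans (G z))"

definition P :: "complex \<Rightarrow> complex^'m^'n" where
  "P z = G z ** W z"

abbreviation M :: "complex^'n^'n \<Rightarrow> complex \<Rightarrow> complex^'m^'m" where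
  "M \<equiv> Mop \<nu> W G"

text \<open>Negative powers of \<open>M\<close> are treated as natural powers of this inverse, to
  which the lemmas on \<open>mpow\<close> apply.\<close>

definition X :: "complex^'n^'n \<Rightarrow> complex \<Rightarrow> complex^'m^'m" where
  "X \<Lambda> z = matrix_inv (M \<Lambda> z)"

lemma continuous_G: "continuous_on circ G"
  using G_lipschitz lipschitz_on_continuous_on by blast

lemma continuous_W: "continuous_on circ W"
  using W_lipschitz lipschitz_on_continuous_on by blast

lemma continuous_P: "continuous_on circ P"
  unfolding P_def by (intro continuous_intros continuous_G continuous_W)

lemma P_lipschitz: "\<exists>L. L-lipschitz_on circ P"
  unfolding P_def
  by (intro lipschitz_on_bounded_bilinear[OF bounded_bilinear_matrix_matrix_mult] compact_circ
      G_lipschitz W_lipschitz)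

lemma M_eq: "M \<Lambda> z = mat 1 + (1 / real \<nu>) *\<^sub>R (ctrans (P z) ** \<Lambda> ** P z)"
  by (simp add: Mop_def P_def ctrans_matrix_mult matrix_mul_assoc)

section \<open>The space spanned by the moments\<close>

lemma cintegrable_moment: "\<Phi> \<in> Splus \<Longrightarrow> cintegrable (\<lambda>z. G z ** \<Phi> z ** ctrans (G z))"
  by (rule cintegrable_sandwich_Splus[OF continuous_G])

text \<open>Integrability is carried through the induction because additivity of the integral
  requires it at each step.\<close>

lemma moment_combination:
  fixes k :: nat
  assumes "\<And>i. i < k \<Longrightarrow> F i \<in> Splus"
  shows "moment (\<lambda>z. \<Sum>i<k. c i *\<^sub>R F i z) = (\<Sum>i<k. c i *\<^sub>R moment (F i))
    \<and> cintegrable (\<lambda>z. G z ** (\<Sum>i<k. c i *\<^sub>R F i z) ** ctrans (G z))"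
  using assms
proof (induction k)
  case 0
  then show ?case by (simp add: moment_def cint_const cintegrable_continuous)
next
  case (Suc k)
  define f where "f z = G z ** (\<Sum>i<k. c i *\<^sub>R F i z) ** ctrans (G z)" for z
  define g where "g z = c k *\<^sub>R (G z ** F k z ** ctrans (G z))" for z
  have split: "G z ** (\<Sum>i<Suc k. c i *\<^sub>R F i z) ** ctrans (G z) = f z + g z" for z
    by (simp add: f_def g_def matrix_mult_algebra)
  have f: "cintegrable f" "cint f = (\<Sum>i<k. c i *\<^sub>R moment (F i))"
    using Suc unfolding f_def moment_def by auto
  have F: "cintegrable (\<lambda>z. G z ** F k z ** ctrans (G z))"
    using Suc.prems by (intro cintegrable_moment) simp
  have g: "cintegrable g" "cint g = c k *\<^sub>R moment (F k)"
    unfolding g_def moment_def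
    by (rule cintegrable_bounded_linear[OF bounded_linear_scaleR_right F],
        rule cint_bounded_linear[OF bounded_linear_scaleR_right F])
  have "cintegrable (\<lambda>z. f z + g z)"
    using f(1) g(1) unfolding cintegrable_def by (rule integrable_add)
  moreover have "cint (\<lambda>z. f z + g z) = (\<Sum>i<Suc k. c i *\<^sub>R moment (F i))"
    by (simp add: cint_add f g)
  ultimately show ?case
    by (simp only: moment_def split)
qed

text \<open>Linearity of \<open>moment\<close> on finite combinations trades the span of densities
  for a \<open>span\<close> of matrices, which supplies the subspace laws and
  \<open>span_minimal\<close>.\<close>

lemma QG_eq_span: "QG G = span (moment ` Splus)"
proof
  show "QG G \<subseteq> span (moment ` Splus)"
  proof
    fix \<Lambda> assume "\<Lambda> \<in> QG G"
    then obtain k c F where F: "\<forall>i<k. F i \<in> Splus"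
      and \<Lambda>: "\<Lambda> = moment (\<lambda>z. \<Sum>i<(k::nat). c i *\<^sub>R F i z)"
      by (auto simp: QG_def rspan_def moment_def)
    have "\<Lambda> = (\<Sum>i<k. c i *\<^sub>R moment (F i))"
      using moment_combination[of k F c] F \<Lambda> by simp
    also have "\<dots> \<in> span (moment ` Splus)"
      using F by (intro span_sum span_scale span_base) auto
    finally show "\<Lambda> \<in> span (moment ` Splus)" .
  qed
  show "span (moment ` Splus) \<subseteq> QG G"
  proof
    fix \<Lambda> assume "\<Lambda> \<in> span (moment ` Splus)"
    then have "\<exists>k c F. (\<forall>i<(k::nat). F i \<in> Splus) \<and> \<Lambda> = (\<Sum>i<k. c i *\<^sub>R moment (F i))"
    proof (induction rule: span_induct_alt)
      case base
      show ?case by (rule exI[of _ 0]) simp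
    next
      case (step a x y)
      then obtain k c F \<Phi> where *: "\<forall>i<(k::nat). F i \<in> Splus" "y = (\<Sum>i<k. c i *\<^sub>R moment (F i))"
        "x = moment \<Phi>" "\<Phi> \<in> Splus" by blast
      have "(\<Sum>i<k. (c(k := a)) i *\<^sub>R moment ((F(k := \<Phi>)) i)) = (\<Sum>i<k. c i *\<^sub>R moment (F i))"
        by (rule sum.cong) auto
      then have "a *\<^sub>R x + y = (\<Sum>i<Suc k. (c(k := a)) i *\<^sub>R moment ((F(k := \<Phi>)) i))"
        using * by (simp add: add.commute)
      moreover have "\<forall>i<Suc k. (F(k := \<Phi>)) i \<in> Splus"
        using * by auto
      ultimately show ?case by blast
    qed
    then obtain k c F where F: "\<forall>i<(k::nat). F i \<in> Splus" and \<Lambda>: "\<Lambda> = (\<Sum>i<k. c i *\<^sub>R moment (F i))"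
      by blast
    then have "\<Lambda> = moment (\<lambda>z. \<Sum>i<k. c i *\<^sub>R F i z)"
      using moment_combination[of k F c] by simp
    moreover have "(\<lambda>z. \<Sum>i<k. c i *\<^sub>R F i z) \<in> rspan Splus"
      unfolding rspan_def using F by blast
    ultimately show "\<Lambda> \<in> QG G"
      unfolding QG_def moment_def
      by (intro CollectI exI[of _ "\<lambda>z. \<Sum>i<k. c i *\<^sub>R F i z"] conjI)
  qed
qed

lemma subspace_QG: "subspace (QG G)"
  unfolding QG_eq_span by (rule subspace_span)

lemma moment_in_QG: "\<Phi> \<in> Splus \<Longrightarrow> moment \<Phi> \<in> QG G"
  unfolding QG_eq_span by (intro span_base imageI)

text \<open>Feasibility says that the identity is a moment. This places \<open>grad\<close> in
  \<open>QG G\<close>, so that the supergradient is itself an admissible direction.\<close>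

lemma mat_1_in_QG: "mat 1 \<in> QG G"
proof -
  obtain \<Phi> where "\<Phi> \<in> Splus" "moment \<Phi> = mat 1" using feasible unfolding moment_def by blast
  then show ?thesis using moment_in_QG[of \<Phi>] by simp
qed

lemma ctrans_moment: "\<Phi> \<in> Splus \<Longrightarrow> ctrans (moment \<Phi>) = moment \<Phi>"
  using cint_bounded_linear[OF bounded_linear_ctrans cintegrable_moment, of \<Phi>]
  by (auto simp: moment_def ctrans_matrix_mult matrix_mul_assoc Splus_def intro!: cint_cong
      dest!: sym[of "cint _" "ctrans _"])

lemma ctrans_QG:
  assumes "\<Lambda> \<in> QG G"
  shows "ctrans \<Lambda> = \<Lambda>"
proof -
  have "subspace {\<Lambda> :: complex^'n^'n. ctrans \<Lambda> = \<Lambda>}"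
    by (auto simp: subspace_def ctrans_linear linear_0[OF bounded_linear.linear[OF bounded_linear_ctrans]])
  then have "span (moment ` Splus) \<subseteq> {\<Lambda>. ctrans \<Lambda> = \<Lambda>}"
    by (intro span_minimal) (auto simp: ctrans_moment)
  then show ?thesis using assms unfolding QG_eq_span by blast
qed

lemma QG_eq_0_if_sandwich_0:
  assumes \<Lambda>: "\<Lambda> \<in> QG G" and 0: "\<And>z. z \<in> circ \<Longrightarrow> ctrans (G z) ** \<Lambda> ** G z = 0"
  shows "\<Lambda> = 0"
proof -
  have "\<Lambda> \<bullet> moment \<Phi> = 0" if "\<Phi> \<in> Splus" for \<Phi>
  proof -
    have "\<Lambda> \<bullet> moment \<Phi> = cint (\<lambda>z. (ctrans (G z) ** \<Lambda> ** G z) \<bullet> \<Phi> z)"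
      unfolding moment_def by (rule inner_cint_sandwich(1)[OF cintegrable_moment[OF that]])
    also have "\<dots> = cint (\<lambda>_. 0)" by (rule cint_cong) (simp add: 0)
    finally show ?thesis by (simp add: cint_const)
  qed
  then have "span (moment ` Splus) \<subseteq> {x. \<Lambda> \<bullet> x = 0}"
    by (intro span_minimal) (auto simp: subspace_hyperplane)
  then have "\<Lambda> \<bullet> \<Lambda> = 0" using \<Lambda> unfolding QG_eq_span by blast
  then show ?thesis by simp
qed

text \<open>Cancelling the invertible \<open>W\<close> leaves a vanishing sandwich of the difference
  by \<open>G\<close>, which only the zero element of \<open>QG G\<close> has. Uniqueness of
  \<open>M\<close> thus becomes uniqueness of the parameter.\<close>

lemma QG_eq_if_M_eq:
  assumes "\<Lambda> \<in> QG G" "\<Lambda>' \<in> QG G" "\<And>z. z \<in> circ \<Longrightarrow> M \<Lambda> z = M \<Lambda>' z"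
  shows "\<Lambda> = \<Lambda>'"
proof -
  have "\<Lambda> - \<Lambda>' = 0"
  proof (rule QG_eq_0_if_sandwich_0)
    show "\<Lambda> - \<Lambda>' \<in> QG G" by (rule subspace_diff[OF subspace_QG assms(1,2)])
    fix z assume z: "z \<in> circ"
    have "ctrans (P z) ** \<Lambda> ** P z = ctrans (P z) ** \<Lambda>' ** P z"
      using assms(3)[OF z] nu by (simp add: M_eq)
    then have "ctrans (W z) ** (ctrans (G z) ** (\<Lambda> - \<Lambda>') ** G z) ** W z = 0"
      by (simp add: P_def ctrans_matrix_mult matrix_mult_algebra matrix_mul_assoc)
    then show "ctrans (G z) ** (\<Lambda> - \<Lambda>') ** G z = 0"
      by (rule matrix_mult_cancel_invertible[OF W_invertible[OF z]])
  qed
  then show ?thesis by simp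
qed

section \<open>The dual functional and its supergradient\<close>

lemma LplusD:
  assumes "\<Lambda> \<in> Lplus \<nu> W G"
  shows "\<Lambda> \<in> QG G" "z \<in> circ \<Longrightarrow> cposdef (M \<Lambda> z)"
  using assms by (auto simp: Lplus_def)

lemma X_inverse:
  assumes "\<Lambda> \<in> Lplus \<nu> W G" "z \<in> circ"
  shows "M \<Lambda> z ** X \<Lambda> z = mat 1" "X \<Lambda> z ** M \<Lambda> z = mat 1" "cposdef (X \<Lambda> z)"
  using matrix_inv_inverse[OF cposdef_invertible[OF LplusD(2)[OF assms]]]
    cposdef_matrix_inv[OF LplusD(2)[OF assms]]
  by (auto simp: X_def)

lemma continuous_M: "continuous_on (U \<times> circ) (\<lambda>y. M (fst y) (snd y))"
  unfolding M_eq
  by (intro continuous_intros continuous_on_compose2[OF continuous_P]) auto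

text \<open>Joint continuity in the parameter and the point makes the integrals of powers of
  \<open>X\<close> continuous in the parameter.\<close>

lemma continuous_X: "continuous_on (Lplus \<nu> W G \<times> circ) (\<lambda>y. X (fst y) (snd y))"
  unfolding X_def
  by (intro continuous_on_matrix_inv continuous_M) (auto intro!: cposdef_invertible simp: Lplus_def)

lemma continuous_X_fixed: "\<Lambda> \<in> Lplus \<nu> W G \<Longrightarrow> continuous_on circ (X \<Lambda>)"
  by (rule continuous_on_compose2[OF continuous_X, of circ "\<lambda>z. (\<Lambda>, z)", simplified])
    (auto intro!: continuous_on_Pair continuous_on_const continuous_on_id)

lemma continuous_M_fixed: "continuous_on circ (M \<Lambda>)"
  unfolding M_eq by (intro continuous_intros continuous_P)

text \<open>Both exponents are negative because \<open>1 < \<nu>\<close>, so \<open>mpowi\<close> is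
  in its inverse branch.\<close>

lemma mpowi_eq:
  "mpowi (M \<Lambda> z) (1 - int \<nu>) = mpow (X \<Lambda> z) (\<nu> - 1)"
  "mpowi (M \<Lambda> z) (- int \<nu>) = mpow (X \<Lambda> z) \<nu>"
proof -
  have "nat (int \<nu> - 1) = \<nu> - 1" using nu by simp
  then show "mpowi (M \<Lambda> z) (1 - int \<nu>) = mpow (X \<Lambda> z) (\<nu> - 1)"
    using nu by (simp add: mpowi_def X_def)
  show "mpowi (M \<Lambda> z) (- int \<nu>) = mpow (X \<Lambda> z) \<nu>"
    using nu by (simp add: mpowi_def X_def)
qed

lemma Jnu_eq:
  assumes "\<Lambda> \<in> Lplus \<nu> W G"
  shows "Jnu \<nu> W G \<Lambda>
    = - (real \<nu> / (real \<nu> - 1)) * cint (\<lambda>z. mat 1 \<bullet> mpow (X \<Lambda> z) (\<nu> - 1)) - mat 1 \<bullet> \<Lambda>"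
proof -
  have "cintegrable (\<lambda>z. trace (mpow (X \<Lambda> z) (\<nu> - 1)))"
    unfolding trace_def
    by (intro cintegrable_continuous continuous_intros continuous_X_fixed assms)
  from cint_bounded_linear[OF bounded_linear_Re this]
  have "Re (cint (\<lambda>z. trace (mpow (X \<Lambda> z) (\<nu> - 1)))) = cint (\<lambda>z. mat 1 \<bullet> mpow (X \<Lambda> z) (\<nu> - 1))"
    by (simp add: Re_trace)
  moreover have "real \<nu> / (1 - real \<nu>) = - (real \<nu> / (real \<nu> - 1))"
    using nu by (simp add: field_simps)
  ultimately show ?thesis
    unfolding Jnu_def mpowi_eq by (simp add: Re_trace)
qed

lemma Phinu_eq: "Phinu \<nu> W G \<Lambda> = (\<lambda>z. W z ** mpow (X \<Lambda> z) \<nu> ** ctrans (W z))"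
  by (simp add: Phinu_def mpowi_eq fun_eq_iff)

text \<open>Congruence with the invertible \<open>W\<close> keeps the power of \<open>X\<close>
  positive definite, and continuity on the circle upgrades this to coercivity.\<close>

lemma Phinu_in_Splus:
  assumes "\<Lambda> \<in> Lplus \<nu> W G"
  shows "Phinu \<nu> W G \<Lambda> \<in> Splus"
  unfolding Phinu_eq
proof (rule continuous_cposdef_in_Splus)
  show "continuous_on circ (\<lambda>z. W z ** mpow (X \<Lambda> z) \<nu> ** ctrans (W z))"
    by (intro continuous_intros continuous_W continuous_X_fixed assms)
  fix z assume z: "z \<in> circ"
  have "W z ** matrix_inv (W z) = mat 1" by (rule matrix_inv_inverse(1)[OF W_invertible[OF z]])
  then have "ctrans (matrix_inv (W z)) ** ctrans (W z) = mat 1"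
    by (metis ctrans_matrix_mult ctrans_mat_1)
  then have "x = 0" if "ctrans (W z) *v x = 0" for x
    using that by (metis matrix_vector_mul_assoc matrix_vector_mul_lid matrix_vector_mult_0_right)
  then have "cposdef (ctrans (ctrans (W z)) ** mpow (X \<Lambda> z) \<nu> ** ctrans (W z))"
    by (intro cposdef_ctrans_mult cposdef_mpow X_inverse(3) assms z)
  then show "cposdef (W z ** mpow (X \<Lambda> z) \<nu> ** ctrans (W z))" by simp
qed

text \<open>Justified as a supergradient of \<open>Jnu\<close> by \<open>Jnu_expansion\<close>; no
  differentiation is involved.\<close>

definition grad :: "complex^'n^'n \<Rightarrow> complex^'n^'n" where
  "grad \<Lambda> = moment (Phinu \<nu> W G \<Lambda>) - mat 1"

lemma grad_in_QG: "\<Lambda> \<in> Lplus \<nu> W G \<Longrightarrow> grad \<Lambda> \<in> QG G"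
  unfolding grad_def by (intro subspace_diff[OF subspace_QG] moment_in_QG Phinu_in_Splus mat_1_in_QG)

lemma moment_Phinu: "moment (Phinu \<nu> W G \<Lambda>) = cint (\<lambda>z. P z ** mpow (X \<Lambda> z) \<nu> ** ctrans (P z))"
  by (simp add: moment_def Phinu_eq P_def ctrans_matrix_mult matrix_mul_assoc)

lemma continuous_grad: "continuous_on (Lplus \<nu> W G) grad"
  unfolding grad_def moment_Phinu
  by (intro continuous_intros continuous_on_cint)
    (unfold case_prod_beta, intro continuous_intros continuous_X continuous_on_compose2[OF continuous_P], auto)

lemma continuous_Jnu: "continuous_on (Lplus \<nu> W G) (Jnu \<nu> W G)"
proof -
  have "continuous_on (Lplus \<nu> W G)
    (\<lambda>\<Lambda>. - (real \<nu> / (real \<nu> - 1)) * cint (\<lambda>z. mat 1 \<bullet> mpow (X \<Lambda> z) (\<nu> - 1)) - mat 1 \<bullet> \<Lambda>)"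
    by (intro continuous_intros continuous_on_cint)
      (unfold case_prod_beta, intro continuous_intros continuous_X)
  then show ?thesis by (rule continuous_on_eq) (simp add: Jnu_eq)
qed

text \<open>The slack in Klein's inequality for the exponent \<open>p = \<nu> - 1\<close>: the
  Bregman divergence of \<open>N \<mapsto> tr N^(-p)\<close> between \<open>M \<Lambda>' z\<close>
  and \<open>M \<Lambda> z\<close>.\<close>

definition gap :: "complex^'n^'n \<Rightarrow> complex^'n^'n \<Rightarrow> complex \<Rightarrow> real" where
  "gap \<Lambda> \<Lambda>' z = mat 1 \<bullet> mpow (X \<Lambda>' z) (\<nu> - 1) + real (\<nu> - 1) * (mpow (X \<Lambda> z) \<nu> \<bullet> M \<Lambda>' z)
    - real \<nu> * (mat 1 \<bullet> mpow (X \<Lambda> z) (\<nu> - 1))"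

lemma continuous_gap:
  assumes "\<Lambda> \<in> Lplus \<nu> W G" "\<Lambda>' \<in> Lplus \<nu> W G"
  shows "continuous_on circ (gap \<Lambda> \<Lambda>')"
  unfolding gap_def by (intro continuous_intros continuous_X_fixed continuous_M_fixed assms)

lemma gap_nonneg:
  assumes "\<Lambda> \<in> Lplus \<nu> W G" "\<Lambda>' \<in> Lplus \<nu> W G" "z \<in> circ"
  shows "0 \<le> gap \<Lambda> \<Lambda>' z"
  using trace_inverse_power_tangent_le[OF X_inverse(3)[OF assms(1,3)] LplusD(2)[OF assms(2,3)]
      X_inverse(1,2)[OF assms(2,3)], of "\<nu> - 1"] nu
  by (simp add: gap_def del: mpow_Suc of_nat_Suc)

lemma gap_eq_0_imp:
  assumes "\<Lambda> \<in> Lplus \<nu> W G" "\<Lambda>' \<in> Lplus \<nu> W G" "z \<in> circ" "gap \<Lambda> \<Lambda>' z = 0"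
  shows "M \<Lambda> z = M \<Lambda>' z"
proof -
  have "X \<Lambda> z = X \<Lambda>' z"
    using trace_inverse_power_tangent_eq[OF X_inverse(3)[OF assms(1,3)] LplusD(2)[OF assms(2,3)]
      X_inverse(1,2)[OF assms(2,3)], of "\<nu> - 1"] nu assms(4)
    by (simp add: gap_def del: mpow_Suc of_nat_Suc)
  then show ?thesis
    by (metis X_inverse(1,2)[OF assms(1,3)] X_inverse(1,2)[OF assms(2,3)] matrix_inv_unique)
qed

text \<open>A first-order expansion with exact remainder. \<open>M\<close> is affine in the
  parameter, so integrating \<open>gap\<close> leaves the change of the trace integral plus a linear
  term, which \<open>inner_cint_sandwich\<close> turns into a pairing with the moment of
  \<open>Phinu\<close>.\<close>

lemma Jnu_expansion:
  assumes \<Lambda>: "\<Lambda> \<in> Lplus \<nu> W G" and \<Lambda>': "\<Lambda>' \<in> Lplus \<nu> W G"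
  shows "Jnu \<nu> W G \<Lambda>' = Jnu \<nu> W G \<Lambda> + grad \<Lambda> \<bullet> (\<Lambda>' - \<Lambda>)
    - real \<nu> / (real \<nu> - 1) * cint (gap \<Lambda> \<Lambda>')"
proof -
  define p where "p = \<nu> - 1"
  have p: "\<nu> = Suc p" "0 < p" using nu by (auto simp: p_def)
  define \<Delta> where "\<Delta> = \<Lambda>' - \<Lambda>"
  define a where "a \<Lambda> z = mat 1 \<bullet> mpow (X \<Lambda> z) p" for \<Lambda> z
  define b where "b z = mpow (X \<Lambda> z) \<nu> \<bullet> (ctrans (P z) ** \<Delta> ** P z)" for z
  have cX: "continuous_on circ (X \<Lambda>)" "continuous_on circ (X \<Lambda>')"
    using continuous_X_fixed \<Lambda> \<Lambda>' by auto
  have ca: "cintegrable (a \<Lambda>)" "cintegrable (a \<Lambda>')"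
    unfolding a_def by (intro cintegrable_continuous continuous_intros cX)+
  have cb: "cintegrable b"
    unfolding b_def by (intro cintegrable_continuous continuous_intros cX continuous_P)
  have "gap \<Lambda> \<Lambda>' z = a \<Lambda>' z - a \<Lambda> z + real p / real \<nu> * b z" if z: "z \<in> circ" for z
  proof -
    \<comment> \<open>One factor of \<open>X\<close> cancels against \<open>M\<close>, lowering the
      exponent from \<open>\<nu>\<close> to \<open>p\<close>.\<close>
    have "mpow (X \<Lambda> z) \<nu> \<bullet> M \<Lambda> z = mat 1 \<bullet> mpow (X \<Lambda> z) p"
    proof -
      have "ctrans (M \<Lambda> z) = M \<Lambda> z" using LplusD(2)[OF \<Lambda> z] by (simp add: cposdef_alt)
      then have "mpow (X \<Lambda> z) \<nu> \<bullet> M \<Lambda> z = (mpow (X \<Lambda> z) \<nu> ** M \<Lambda> z) \<bullet> mat 1"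
        using inner_matrix_mult_right[of "mpow (X \<Lambda> z) \<nu>" "M \<Lambda> z" "mat 1"] by simp
      also have "mpow (X \<Lambda> z) \<nu> ** M \<Lambda> z = mpow (X \<Lambda> z) p ** (X \<Lambda> z ** M \<Lambda> z)"
        by (simp only: p(1) mpow_Suc matrix_mul_assoc)
      finally show ?thesis by (simp add: X_inverse(2)[OF \<Lambda> z] inner_commute)
    qed
    moreover have "M \<Lambda>' z = M \<Lambda> z + (1 / real \<nu>) *\<^sub>R (ctrans (P z) ** \<Delta> ** P z)"
      by (simp add: M_eq \<Delta>_def matrix_mult_algebra scaleR_diff_right)
    ultimately have "mpow (X \<Lambda> z) \<nu> \<bullet> M \<Lambda>' z = a \<Lambda> z + b z / real \<nu>"
      by (simp only: inner_add_right inner_scaleR_right a_def b_def) simp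
    then show ?thesis
      unfolding gap_def p_def[symmetric] a_def[symmetric]
      using p(1) by (simp add: algebra_simps)
  qed
  then have "cint (gap \<Lambda> \<Lambda>') = cint (\<lambda>z. a \<Lambda>' z - a \<Lambda> z + real p / real \<nu> * b z)"
    by (rule cint_cong)
  also have "\<dots> = cint (\<lambda>z. a \<Lambda>' z - a \<Lambda> z) + cint (\<lambda>z. real p / real \<nu> * b z)"
  proof (rule cint_add)
    show "cintegrable (\<lambda>z. a \<Lambda>' z - a \<Lambda> z)"
      using ca unfolding cintegrable_def by (intro integrable_diff)
    show "cintegrable (\<lambda>z. real p / real \<nu> * b z)"
      by (rule cintegrable_bounded_linear[OF bounded_linear_mult_right cb])
  qed
  also have "\<dots> = cint (a \<Lambda>') - cint (a \<Lambda>) + real p / real \<nu> * cint b"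
    by (simp only: cint_diff[OF ca(2,1)] cint_mult_left[OF cb])
  finally have gap: "cint (gap \<Lambda> \<Lambda>') = cint (a \<Lambda>') - cint (a \<Lambda>) + real p / real \<nu> * cint b" .
  have "cint b = \<Delta> \<bullet> moment (Phinu \<nu> W G \<Lambda>)"
  proof -
    have "cintegrable (\<lambda>z. P z ** mpow (X \<Lambda> z) \<nu> ** ctrans (P z))"
      by (intro cintegrable_continuous continuous_intros cX continuous_P)
    from inner_cint_sandwich(1)[OF this, of \<Delta>] show ?thesis
      by (simp add: moment_Phinu b_def[abs_def] inner_commute)
  qed
  then have b: "cint b = grad \<Lambda> \<bullet> \<Delta> + mat 1 \<bullet> \<Delta>"
    by (simp add: grad_def inner_diff_right inner_commute[of _ \<Delta>])
  have rp: "real \<nu> - 1 = real p" using p by simp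
  have J: "Jnu \<nu> W G \<Lambda> = - (real \<nu> / real p) * cint (a \<Lambda>) - mat 1 \<bullet> \<Lambda>"
    "Jnu \<nu> W G \<Lambda>' = - (real \<nu> / real p) * cint (a \<Lambda>') - mat 1 \<bullet> \<Lambda>'"
    using Jnu_eq[OF \<Lambda>] Jnu_eq[OF \<Lambda>'] unfolding a_def[abs_def] rp p_def[symmetric] by blast+
  have "real \<nu> / (real \<nu> - 1) * cint (gap \<Lambda> \<Lambda>')
      = real \<nu> / real p * (cint (a \<Lambda>') - cint (a \<Lambda>)) + cint b"
    using p(2) nu unfolding gap rp by (simp add: distrib_left)
  then show ?thesis
    unfolding J b by (simp add: \<Delta>_def inner_diff_right algebra_simps)
qed

section \<open>A priori bounds on superlevel sets\<close>

lemma zero_in_Lplus: "0 \<in> Lplus \<nu> W G"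
  using subspace_0[OF subspace_QG] by (simp add: Lplus_def M_eq cposdef_mat_1)

text \<open>The integral is a norm on the finite-dimensional \<open>QG G\<close>, definite by
  \<open>QG_eq_0_if_sandwich_0\<close>; its minimum over the unit sphere of \<open>QG G\<close> is
  the constant.\<close>

lemma sandwich_norm_lower:
  "\<exists>\<kappa>>0. \<forall>\<Lambda>\<in>QG G. \<kappa> * norm \<Lambda> \<le> cint (\<lambda>z. norm (ctrans (G z) ** \<Lambda> ** G z))"
proof -
  define N where "N \<Lambda> = cint (\<lambda>z. norm (ctrans (G z) ** \<Lambda> ** G z))" for \<Lambda>
  define S where "S = QG G \<inter> sphere 0 1"
  have cont: "continuous_on circ (\<lambda>z. norm (ctrans (G z) ** \<Lambda> ** G z))" for \<Lambda>
    by (intro continuous_intros continuous_G)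
  have scale: "N (c *\<^sub>R \<Lambda>) = \<bar>c\<bar> * N \<Lambda>" for c \<Lambda>
    unfolding N_def
    by (simp add: matrix_mult_algebra cint_mult_left[OF cintegrable_continuous[OF cont]])
  have unit: "\<exists>u\<in>S. \<Lambda> = norm \<Lambda> *\<^sub>R u" if "\<Lambda> \<in> QG G" "\<Lambda> \<noteq> 0" for \<Lambda>
    using that subspace_scale[OF subspace_QG that(1), of "1 / norm \<Lambda>"]
    by (intro bexI[of _ "(1 / norm \<Lambda>) *\<^sub>R \<Lambda>"]) (auto simp: S_def)
  show ?thesis
  proof (cases "S = {}")
    case True
    then have "\<Lambda> = 0" if "\<Lambda> \<in> QG G" for \<Lambda> using unit that by blast
    moreover have "1 * norm (0 :: complex^'n^'n) \<le> N 0"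
      using scale[of 0 0] by simp
    ultimately have "\<forall>\<Lambda>\<in>QG G. 1 * norm \<Lambda> \<le> N \<Lambda>" by blast
    then show ?thesis unfolding N_def by (intro exI[of _ 1]) simp
  next
    case False
    have "compact S"
      unfolding S_def by (intro closed_Int_compact closed_subspace subspace_QG compact_sphere)
    moreover have "continuous_on S N"
      unfolding N_def
      by (intro continuous_on_cint)
        (unfold case_prod_beta, intro continuous_intros continuous_on_compose2[OF continuous_G], auto)
    ultimately have "\<exists>u\<in>S. \<forall>v\<in>S. N u \<le> N v"
      using False by (intro continuous_attains_inf)
    then obtain u where u: "u \<in> S" "\<forall>v\<in>S. N u \<le> N v" by auto
    have "0 \<le> N u"
      unfolding N_def by (intro cint_nonneg cintegrable_continuous cont) simp
    moreover have "N u \<noteq> 0"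
    proof
      assume "N u = 0"
      then have "norm (ctrans (G z) ** u ** G z) = 0" if "z \<in> circ" for z
        unfolding N_def by (intro cint_eq_0_imp[OF cont _ _ that]) auto
      then have "u = 0" using u(1) by (intro QG_eq_0_if_sandwich_0) (auto simp: S_def)
      then show False using u(1) by (simp add: S_def)
    qed
    ultimately have pos: "0 < N u" by simp
    have "N u * norm \<Lambda> \<le> N \<Lambda>" if \<Lambda>: "\<Lambda> \<in> QG G" for \<Lambda>
    proof (cases "\<Lambda> = 0")
      case True
      then show ?thesis using scale[of 0 0] by simp
    next
      case False
      obtain v where v: "v \<in> S" "\<Lambda> = norm \<Lambda> *\<^sub>R v" using unit[OF \<Lambda> False] by blast
      have "N u * norm \<Lambda> \<le> N v * norm \<Lambda>"
        using u(2) v(1) by (intro mult_right_mono) auto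
      also have "\<dots> = N (norm \<Lambda> *\<^sub>R v)" by (simp add: scale)
      finally show ?thesis using v(2) by simp
    qed
    then show ?thesis using pos unfolding N_def by blast
  qed
qed

text \<open>Positivity of \<open>M\<close> bounds \<open>G* \<Lambda> G\<close> from below, the
  coercive feasible density controls the trace from above, and its moment, the identity, turns the
  integrated pairing into \<open>tr \<Lambda>\<close>.\<close>

lemma sandwich_norm_upper:
  "\<exists>a b. 0 \<le> b \<and>
    (\<forall>\<Lambda>\<in>Lplus \<nu> W G. cint (\<lambda>z. norm (ctrans (G z) ** \<Lambda> ** G z)) \<le> a + b * (mat 1 \<bullet> \<Lambda>))"
proof -
  obtain \<Phi> where \<Phi>: "\<Phi> \<in> Splus" and mom: "moment \<Phi> = mat 1"
    using feasible unfolding moment_def by blast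
  obtain C \<epsilon> where C: "\<forall>z\<in>circ. norm (\<Phi> z) \<le> C" and \<epsilon>: "0 < \<epsilon>"
    and coercive: "\<forall>z\<in>circ. \<forall>x. \<epsilon> * (norm x)\<^sup>2 \<le> x \<bullet> (\<Phi> z *v x)"
    and herm: "\<forall>z\<in>circ. ctrans (\<Phi> z) = \<Phi> z"
    using \<Phi> unfolding Splus_def Re_cqform by auto
  define U where "U z = matrix_inv (W z)" for z
  \<comment> \<open>The congruence by the inverse of \<open>W\<close> sends \<open>M\<close> to
    \<open>Q + S / \<nu>\<close> with \<open>S = G* \<Lambda> G\<close>: up to a bounded term,
    \<open>S / \<nu>\<close> is positive semidefinite.\<close>
  define Q where "Q z = ctrans (U z) ** U z" for z
  have WU: "W z ** U z = mat 1" if "z \<in> circ" for z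
    unfolding U_def by (rule matrix_inv_inverse(1)[OF W_invertible[OF that]])
  have "continuous_on circ Q"
    unfolding Q_def U_def
    by (intro continuous_intros continuous_on_matrix_inv continuous_W W_invertible)
  from compact_norm_bound[OF compact_circ this]
  obtain D where D: "0 \<le> D" "\<forall>z\<in>circ. norm (Q z) \<le> D" by blast
  define K where "K = real \<nu> * (D * C / \<epsilon> + D)"
  have pointwise: "norm (ctrans (G z) ** \<Lambda> ** G z) \<le> 1 / \<epsilon> * ((ctrans (G z) ** \<Lambda> ** G z) \<bullet> \<Phi> z) + K"
    if \<Lambda>: "\<Lambda> \<in> Lplus \<nu> W G" and z: "z \<in> circ" for \<Lambda> z
  proof -
    define S where "S = ctrans (G z) ** \<Lambda> ** G z"
    define N where "N = ctrans (U z) ** M \<Lambda> z ** U z"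
    have "psd N"
      unfolding N_def by (intro psd_ctrans_mult cposdef_imp_psd LplusD(2)[OF \<Lambda> z])
    have "ctrans (U z) ** (ctrans (W z) ** S ** W z) ** U z = ctrans (W z ** U z) ** S ** (W z ** U z)"
      by (simp only: ctrans_matrix_mult matrix_mul_assoc)
    then have USU: "ctrans (U z) ** (ctrans (W z) ** S ** W z) ** U z = S"
      by (simp add: WU[OF z])
    have "M \<Lambda> z = mat 1 + (1 / real \<nu>) *\<^sub>R (ctrans (W z) ** S ** W z)"
      by (simp add: M_eq P_def S_def ctrans_matrix_mult matrix_mul_assoc)
    then have N: "N = Q z + (1 / real \<nu>) *\<^sub>R S"
      by (simp only: N_def Q_def matrix_mult_algebra matrix_mul_rid USU)
    then have S: "S = real \<nu> *\<^sub>R (N - Q z)"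
      using nu by simp
    have tr: "norm N \<le> mat 1 \<bullet> N" by (rule psd_norm_le_trace[OF \<open>psd N\<close>])
    \<comment> \<open>Coercivity enters as positivity of this difference, whose pairing with
      \<open>N\<close> is therefore nonnegative.\<close>
    have "psd (\<Phi> z - \<epsilon> *\<^sub>R mat 1)"
      using coercive herm z
      by (simp add: psd_def ctrans_linear matrix_vector_mult_algebra inner_diff_right power2_norm_eq_inner)
    from inner_psd_nonneg[OF \<open>psd N\<close> this]
    have N\<Phi>: "\<epsilon> * (mat 1 \<bullet> N) \<le> N \<bullet> \<Phi> z"
      by (simp add: inner_diff_right inner_commute)
    have "Q z \<bullet> \<Phi> z \<le> norm (Q z) * norm (\<Phi> z)" by (rule norm_cauchy_schwarz)
    also have "\<dots> \<le> D * C" using D C z by (intro mult_mono) auto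
    finally have "\<epsilon> * (mat 1 \<bullet> N) \<le> (N - Q z) \<bullet> \<Phi> z + D * C"
      using N\<Phi> by (simp add: inner_diff_left)
    then have trN: "mat 1 \<bullet> N \<le> ((N - Q z) \<bullet> \<Phi> z + D * C) / \<epsilon>"
      using \<epsilon> by (simp add: field_simps)
    have "norm S = real \<nu> * norm (N - Q z)" by (simp add: S)
    also have "\<dots> \<le> real \<nu> * (((N - Q z) \<bullet> \<Phi> z + D * C) / \<epsilon> + D)"
    proof (rule mult_left_mono)
      have "norm (N - Q z) \<le> norm N + norm (Q z)" by (rule norm_triangle_ineq4)
      also have "\<dots> \<le> ((N - Q z) \<bullet> \<Phi> z + D * C) / \<epsilon> + D"
        using tr trN D z by (intro add_mono) auto
      finally show "norm (N - Q z) \<le> ((N - Q z) \<bullet> \<Phi> z + D * C) / \<epsilon> + D" .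
    qed simp
    also have "\<dots> = 1 / \<epsilon> * (real \<nu> * ((N - Q z) \<bullet> \<Phi> z)) + K"
      by (simp add: K_def add_divide_distrib distrib_left del: inner_diff_left)
    also have "real \<nu> * ((N - Q z) \<bullet> \<Phi> z) = S \<bullet> \<Phi> z"
      by (simp only: S inner_scaleR_left)
    finally show ?thesis by (simp only: S_def)
  qed
  have "cint (\<lambda>z. norm (ctrans (G z) ** \<Lambda> ** G z)) \<le> K + 1 / \<epsilon> * (mat 1 \<bullet> \<Lambda>)"
    if \<Lambda>: "\<Lambda> \<in> Lplus \<nu> W G" for \<Lambda>
  proof -
    define f where "f z = (ctrans (G z) ** \<Lambda> ** G z) \<bullet> \<Phi> z" for z
    have f: "cintegrable f" "cint f = \<Lambda> \<bullet> moment \<Phi>"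
      unfolding f_def moment_def
      using inner_cint_sandwich[OF cintegrable_moment[OF \<Phi>], of \<Lambda>] by auto
    have f': "cintegrable (\<lambda>z. 1 / \<epsilon> * f z)"
      by (rule cintegrable_bounded_linear[OF bounded_linear_mult_right f(1)])
    have const: "cintegrable (\<lambda>_. K)" by (intro cintegrable_continuous continuous_on_const)
    have "cint (\<lambda>z. norm (ctrans (G z) ** \<Lambda> ** G z)) \<le> cint (\<lambda>z. 1 / \<epsilon> * f z + K)"
    proof (rule cint_mono)
      show "cintegrable (\<lambda>z. norm (ctrans (G z) ** \<Lambda> ** G z))"
        by (intro cintegrable_continuous continuous_intros continuous_G)
      show "cintegrable (\<lambda>z. 1 / \<epsilon> * f z + K)"
        using f' const unfolding cintegrable_def by (rule integrable_add)
    qed (use pointwise[OF \<Lambda>] in \<open>simp add: f_def\<close>)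
    also have "\<dots> = 1 / \<epsilon> * cint f + K"
      by (simp only: cint_add[OF f' const] cint_mult_left[OF f(1)] cint_const)
    finally show ?thesis by (simp add: f(2) mom inner_commute)
  qed
  then show ?thesis using \<epsilon> by (intro exI[of _ K] exI[of _ "1 / \<epsilon>"]) auto
qed

lemma trace_power_nonneg:
  "\<Lambda> \<in> Lplus \<nu> W G \<Longrightarrow> z \<in> circ \<Longrightarrow> 0 \<le> mat 1 \<bullet> mpow (X \<Lambda> z) k"
  by (intro psd_trace_nonneg psd_mpow cposdef_imp_psd X_inverse(3))

lemma cintegrable_trace_power:
  "\<Lambda> \<in> Lplus \<nu> W G \<Longrightarrow> cintegrable (\<lambda>z. mat 1 \<bullet> mpow (X \<Lambda> z) k)"
  by (intro cintegrable_continuous continuous_intros continuous_X_fixed)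

text \<open>The trace integral is nonnegative, so a lower bound on \<open>Jnu\<close> caps
  \<open>tr \<Lambda>\<close>. The two sandwich estimates then cap the norm, and the norm bound fed
  back into \<open>Jnu\<close> caps the integral.\<close>

lemma superlevel_bounded:
  "\<exists>R K. \<forall>\<Lambda>\<in>Lplus \<nu> W G. Jnu \<nu> W G 0 \<le> Jnu \<nu> W G \<Lambda> \<longrightarrow>
    norm \<Lambda> \<le> R \<and> cint (\<lambda>z. mat 1 \<bullet> mpow (X \<Lambda> z) (\<nu> - 1)) \<le> K"
proof -
  obtain \<kappa> where \<kappa>: "0 < \<kappa>"
    "\<forall>\<Lambda>\<in>QG G. \<kappa> * norm \<Lambda> \<le> cint (\<lambda>z. norm (ctrans (G z) ** \<Lambda> ** G z))"
    using sandwich_norm_lower by blast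
  obtain a b where ab: "0 \<le> b"
    "\<forall>\<Lambda>\<in>Lplus \<nu> W G. cint (\<lambda>z. norm (ctrans (G z) ** \<Lambda> ** G z)) \<le> a + b * (mat 1 \<bullet> \<Lambda>)"
    using sandwich_norm_upper by blast
  define J0 where "J0 = Jnu \<nu> W G 0"
  define R where "R = (a + b * (- J0)) / \<kappa>"
  define r where "r = real \<nu> / (real \<nu> - 1)"
  have r: "0 < r" using nu by (simp add: r_def)
  define K where "K = (- J0 + norm (mat 1 :: complex^'n^'n) * R) / r"
  have "norm \<Lambda> \<le> R \<and> cint (\<lambda>z. mat 1 \<bullet> mpow (X \<Lambda> z) (\<nu> - 1)) \<le> K"
    if \<Lambda>: "\<Lambda> \<in> Lplus \<nu> W G" and J: "J0 \<le> Jnu \<nu> W G \<Lambda>" for \<Lambda>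
  proof -
    define c where "c = cint (\<lambda>z. mat 1 \<bullet> mpow (X \<Lambda> z) (\<nu> - 1))"
    have "0 \<le> c"
      unfolding c_def by (intro cint_nonneg cintegrable_trace_power trace_power_nonneg \<Lambda>)
    have J': "J0 \<le> - r * c - mat 1 \<bullet> \<Lambda>"
      using J Jnu_eq[OF \<Lambda>] by (simp add: r_def c_def)
    moreover have "0 \<le> r * c" using r \<open>0 \<le> c\<close> by simp
    ultimately have "mat 1 \<bullet> \<Lambda> \<le> - J0" by simp
    then have "b * (mat 1 \<bullet> \<Lambda>) \<le> b * (- J0)" using ab(1) by (rule mult_left_mono)
    moreover have "\<kappa> * norm \<Lambda> \<le> a + b * (mat 1 \<bullet> \<Lambda>)"
      using \<kappa>(2) ab(2) \<Lambda> LplusD(1)[OF \<Lambda>] by force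
    ultimately have "norm \<Lambda> * \<kappa> \<le> a + b * (- J0)" by (simp add: mult.commute)
    then have R: "norm \<Lambda> \<le> R" unfolding R_def using \<kappa>(1) by (simp only: pos_le_divide_eq)
    have "- (mat 1 \<bullet> \<Lambda>) \<le> norm (mat 1 :: complex^'n^'n) * norm \<Lambda>"
      using Cauchy_Schwarz_ineq2[of "mat 1" \<Lambda>] by simp
    also have "\<dots> \<le> norm (mat 1 :: complex^'n^'n) * R" using R by (intro mult_left_mono) auto
    finally have "c * r \<le> - J0 + norm (mat 1 :: complex^'n^'n) * R"
      using J' by (simp add: mult.commute)
    then have "c \<le> K" unfolding K_def using r by (simp only: pos_le_divide_eq)
    with R show ?thesis by (simp add: c_def)
  qed
  then show ?thesis unfolding J0_def by blast
qed

section \<open>The barrier at the boundary of \<open>Lplus\<close>\<close>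

lemma M_lipschitz:
  "\<exists>L>0. \<forall>\<Lambda> z w. norm \<Lambda> \<le> R \<longrightarrow> z \<in> circ \<longrightarrow> w \<in> circ \<longrightarrow> norm (M \<Lambda> z - M \<Lambda> w) \<le> L * norm (z - w)"
proof -
  obtain LP where LP: "LP-lipschitz_on circ P" using P_lipschitz by blast
  obtain C where C: "0 \<le> C" "\<forall>z\<in>circ. norm (P z) \<le> C"
    using compact_norm_bound[OF compact_circ continuous_P] by blast
  have LP0: "0 \<le> LP" by (rule lipschitz_on_nonneg[OF LP])
  \<comment> \<open>The absolute value covers negative \<open>R\<close>; the summand 1 makes
    \<open>L\<close> positive, since the barrier estimate divides by it.\<close>
  define L where "L = 2 * LP * \<bar>R\<bar> * C + 1"
  have "norm (M \<Lambda> z - M \<Lambda> w) \<le> L * norm (z - w)"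
    if \<Lambda>: "norm \<Lambda> \<le> R" and z: "z \<in> circ" and w: "w \<in> circ" for \<Lambda> z w
  proof -
    define E where "E = P z - P w"
    have E: "norm E \<le> LP * norm (z - w)"
      using lipschitz_onD[OF LP z w] by (simp add: E_def dist_norm)
    have mult3: "norm (A ** \<Lambda> ** B) \<le> norm A * norm \<Lambda> * norm B"
      for A :: "complex^'n^'m" and B :: "complex^'m^'n"
      by (rule order_trans[OF norm_matrix_matrix_mult_le mult_right_mono[OF norm_matrix_matrix_mult_le]]) simp
    have "M \<Lambda> z - M \<Lambda> w = (1 / real \<nu>) *\<^sub>R (ctrans E ** \<Lambda> ** P z + ctrans (P w) ** \<Lambda> ** E)"
      by (simp add: M_eq E_def ctrans_linear matrix_mult_algebra scaleR_diff_right scaleR_add_right)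
    then have "norm (M \<Lambda> z - M \<Lambda> w) = 1 / real \<nu> * norm (ctrans E ** \<Lambda> ** P z + ctrans (P w) ** \<Lambda> ** E)"
      by simp
    also have "\<dots> \<le> 1 * norm (ctrans E ** \<Lambda> ** P z + ctrans (P w) ** \<Lambda> ** E)"
      using nu by (intro mult_right_mono) auto
    also have "\<dots> \<le> norm E * norm \<Lambda> * norm (P z) + norm (P w) * norm \<Lambda> * norm E"
      using norm_triangle_ineq[of "ctrans E ** \<Lambda> ** P z" "ctrans (P w) ** \<Lambda> ** E"]
        mult3[of "ctrans E" "P z"] mult3[of "ctrans (P w)" E] by simp
    also have "\<dots> \<le> (LP * norm (z - w)) * \<bar>R\<bar> * C + C * \<bar>R\<bar> * (LP * norm (z - w))"
      using E \<Lambda> C z w LP0 by (intro add_mono mult_mono) auto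
    also have "\<dots> = 2 * LP * \<bar>R\<bar> * C * norm (z - w)" by simp
    also have "\<dots> \<le> L * norm (z - w)" by (simp add: L_def mult_right_mono)
    finally show ?thesis .
  qed
  moreover have "0 < L" using LP0 C(1) by (simp add: L_def add_nonneg_pos)
  ultimately show ?thesis by blast
qed

text \<open>The barrier property: if the smallest eigenvalue of \<open>M \<Lambda>\<close> were small somewhere, Lipschitz
  continuity would keep it below a linear function nearby, whose inverse has a large integral.\<close>

lemma uniformly_coercive:
  "\<exists>c>0. \<forall>\<Lambda>\<in>Lplus \<nu> W G. norm \<Lambda> \<le> R \<longrightarrow> cint (\<lambda>z. mat 1 \<bullet> mpow (X \<Lambda> z) (\<nu> - 1)) \<le> K \<longrightarrow>
    (\<forall>z\<in>circ. \<forall>x. c * (norm x)\<^sup>2 \<le> x \<bullet> (M \<Lambda> z *v x))"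
proof -
  obtain L where L: "0 < L"
    "\<forall>\<Lambda> z w. norm \<Lambda> \<le> R \<longrightarrow> z \<in> circ \<longrightarrow> w \<in> circ \<longrightarrow> norm (M \<Lambda> z - M \<Lambda> w) \<le> L * norm (z - w)"
    using M_lipschitz[of R] by blast
  define p where "p = \<nu> - 1"
  have p: "1 \<le> p" using nu by (simp add: p_def)
  define B where "B = real p * real CARD('m)"
  \<comment> \<open>Solves \<open>ln (L * pi) - ln c = L * (2 * pi * (K + B))\<close>, the extreme
    case of the logarithmic estimate below.\<close>
  define c where "c = L * pi * exp (- (L * (2 * pi * (K + B))))"
  have "c * (norm x)\<^sup>2 \<le> x \<bullet> (M \<Lambda> z *v x)"
    if \<Lambda>: "\<Lambda> \<in> Lplus \<nu> W G" and R: "norm \<Lambda> \<le> R"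
      and K: "cint (\<lambda>z. mat 1 \<bullet> mpow (X \<Lambda> z) p) \<le> K" and z: "z \<in> circ" for \<Lambda> z x
  proof (rule quadratic_form_ge_if_unit)
    fix x :: "complex^'m" assume x: "norm x = 1"
    obtain \<theta>0 where \<theta>0: "\<theta>0 \<in> {-pi..pi}" "z = cis \<theta>0" using circ_cisE[OF z] by blast
    define s where "s = x \<bullet> (M \<Lambda> z *v x)"
    have q_pos: "0 < x \<bullet> (M \<Lambda> w *v x)" if "w \<in> circ" for w
    proof -
      have "x \<noteq> 0" using x by auto
      then show ?thesis using LplusD(2)[OF \<Lambda> that] by (simp add: cposdef_alt)
    qed
    then have s: "0 < s" unfolding s_def using z by blast
    \<comment> \<open>The test vector \<open>x\<close> stays fixed while \<open>\<theta>\<close>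
      moves: its quadratic form grows at most linearly from \<open>s\<close>, and the reciprocal
      bounds the trace of \<open>X\<close> from below.\<close>
    have lower: "1 / (s + L * \<bar>\<theta> - \<theta>0\<bar>) \<le> mat 1 \<bullet> mpow (X \<Lambda> (cis \<theta>)) p + B" for \<theta>
    proof -
      define D where "D = M \<Lambda> (cis \<theta>) - M \<Lambda> z"
      have "x \<bullet> (D *v x) \<le> norm x * (norm D * norm x)"
        by (rule order_trans[OF norm_cauchy_schwarz mult_left_mono[OF norm_matrix_vector_mult_le]]) simp
      also have "\<dots> \<le> L * norm (cis \<theta> - z)"
        using L(2) R z cis_in_circ[of \<theta>] by (simp add: x D_def)
      also have "\<dots> \<le> L * \<bar>\<theta> - \<theta>0\<bar>"
        using dist_cis_le[of \<theta> \<theta>0] L(1) by (simp add: \<theta>0(2))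
      finally have "x \<bullet> (M \<Lambda> (cis \<theta>) *v x) \<le> s + L * \<bar>\<theta> - \<theta>0\<bar>"
        by (simp add: D_def s_def matrix_vector_mult_algebra inner_diff_right)
      then have "1 / (s + L * \<bar>\<theta> - \<theta>0\<bar>) \<le> 1 / (x \<bullet> (M \<Lambda> (cis \<theta>) *v x))"
        using q_pos[of "cis \<theta>"] by (intro divide_left_mono) (auto intro!: mult_pos_pos)
      also have "\<dots> \<le> mat 1 \<bullet> X \<Lambda> (cis \<theta>)"
        unfolding X_def by (rule trace_inverse_ge[OF LplusD(2)[OF \<Lambda> cis_in_circ] x])
      \<comment> \<open>The factor \<open>p\<close>, at least 1, matches Bernoulli's estimate, which
        passes to the \<open>p\<close>-th power at the cost of \<open>B\<close>.\<close>
      also have "\<dots> \<le> real p * (mat 1 \<bullet> X \<Lambda> (cis \<theta>))"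
        using trace_power_nonneg[OF \<Lambda> cis_in_circ, of \<theta> 1] p by (simp add: mult_le_cancel_right1)
      also have "\<dots> \<le> mat 1 \<bullet> mpow (X \<Lambda> (cis \<theta>)) p + B"
        using trace_mpow_bernoulli[OF X_inverse(3)[OF \<Lambda> cis_in_circ], of p \<theta>] by (simp add: B_def)
      finally show ?thesis .
    qed
    have pos: "0 < s + L * \<bar>\<theta> - \<theta>0\<bar>" for \<theta>
      using s L by (intro add_pos_nonneg) auto
    have "(ln (s + L * pi) - ln s) / L \<le> integral {-pi..pi} (\<lambda>\<theta>. 1 / (s + L * \<bar>\<theta> - \<theta>0\<bar>))"
      by (rule integral_inverse_abs_ge[OF s L(1) \<theta>0(1)])
    also have "\<dots> \<le> integral {-pi..pi} (\<lambda>\<theta>. mat 1 \<bullet> mpow (X \<Lambda> (cis \<theta>)) p + B)"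
    proof (rule integral_le)
      show "(\<lambda>\<theta>. 1 / (s + L * \<bar>\<theta> - \<theta>0\<bar>)) integrable_on {-pi..pi}"
        using pos by (intro integrable_continuous_real continuous_intros) (auto simp: less_imp_neq[symmetric])
      show "(\<lambda>\<theta>. mat 1 \<bullet> mpow (X \<Lambda> (cis \<theta>)) p + B) integrable_on {-pi..pi}"
        using cintegrable_trace_power[OF \<Lambda>] unfolding cintegrable_def
        by (intro integrable_add integrable_const_ivl)
    qed (rule lower)
    also have "\<dots> = integral {-pi..pi} (\<lambda>\<theta>. mat 1 \<bullet> mpow (X \<Lambda> (cis \<theta>)) p) + 2 * pi * B"
      using cintegrable_trace_power[OF \<Lambda>, of p] unfolding cintegrable_def
      by (subst integral_add) auto
    also have "\<dots> = 2 * pi * (cint (\<lambda>z. mat 1 \<bullet> mpow (X \<Lambda> z) p) + B)"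
      by (simp add: cint_def field_simps)
    also have "\<dots> \<le> 2 * pi * (K + B)" using K by (intro mult_left_mono) auto
    finally have "ln (s + L * pi) - ln s \<le> L * (2 * pi * (K + B))"
      using L(1) by (simp only: pos_divide_le_eq mult.commute)
    moreover have "ln (L * pi) \<le> ln (s + L * pi)" using s L(1) by (intro ln_mono) auto
    ultimately have "ln (L * pi) + - (L * (2 * pi * (K + B))) \<le> ln s" by linarith
    then have "exp (ln (L * pi) + - (L * (2 * pi * (K + B)))) \<le> exp (ln s)" by (simp only: exp_le_cancel_iff)
    then show "c \<le> x \<bullet> (M \<Lambda> z *v x)"
      using s L(1) unfolding exp_add by (simp add: c_def s_def[symmetric])
  qed
  moreover have "0 < c" using L(1) by (simp add: c_def)
  ultimately show ?thesis unfolding p_def by blast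
qed

section \<open>Existence, stationarity and uniqueness of the maximizer\<close>

lemma Lplus_if_coercive:
  assumes "\<Lambda> \<in> QG G" "0 < c" "\<And>z x. z \<in> circ \<Longrightarrow> c * (norm x)\<^sup>2 \<le> x \<bullet> (M \<Lambda> z *v x)"
  shows "\<Lambda> \<in> Lplus \<nu> W G"
proof -
  have "cposdef (M \<Lambda> z)" if "z \<in> circ" for z
    unfolding cposdef_alt
  proof (intro conjI allI impI)
    show "ctrans (M \<Lambda> z) = M \<Lambda> z"
      by (simp add: M_eq ctrans_linear ctrans_matrix_mult ctrans_QG[OF assms(1)] matrix_mul_assoc)
    fix x :: "complex^'m" assume "x \<noteq> 0"
    then have "0 < c * (norm x)\<^sup>2" using assms(2) by simp
    also note assms(3)[OF that]
    finally show "0 < x \<bullet> (M \<Lambda> z *v x)" .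
  qed
  then show ?thesis using assms(1) by (simp add: Lplus_def)
qed

text \<open>Uniform coercivity is a closed condition, unlike the strict positivity in
  \<open>Lplus\<close>, and the resulting compact set contains the whole superlevel set of 0. The
  constant \<open>c\<close> is kept as room for perturbing the maximizer.\<close>

lemma maximizer_exists:
  "\<exists>\<Lambda>0\<in>Lplus \<nu> W G. \<exists>c>0. (\<forall>z\<in>circ. \<forall>x. c * (norm x)\<^sup>2 \<le> x \<bullet> (M \<Lambda>0 z *v x)) \<and>
    (\<forall>\<Lambda>\<in>Lplus \<nu> W G. Jnu \<nu> W G \<Lambda> \<le> Jnu \<nu> W G \<Lambda>0)"
proof -
  obtain R K where RK: "\<forall>\<Lambda>\<in>Lplus \<nu> W G. Jnu \<nu> W G 0 \<le> Jnu \<nu> W G \<Lambda> \<longrightarrow>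
    norm \<Lambda> \<le> R \<and> cint (\<lambda>z. mat 1 \<bullet> mpow (X \<Lambda> z) (\<nu> - 1)) \<le> K"
    using superlevel_bounded by blast
  obtain c where c: "0 < c" and coercive: "\<forall>\<Lambda>\<in>Lplus \<nu> W G. norm \<Lambda> \<le> R \<longrightarrow>
    cint (\<lambda>z. mat 1 \<bullet> mpow (X \<Lambda> z) (\<nu> - 1)) \<le> K \<longrightarrow>
    (\<forall>z\<in>circ. \<forall>x. c * (norm x)\<^sup>2 \<le> x \<bullet> (M \<Lambda> z *v x))"
    using uniformly_coercive[of R K] by blast
  define S where "S = (QG G \<inter> cball 0 R) \<inter> (\<Inter>z\<in>circ. \<Inter>x. {\<Lambda>. c * (norm x)\<^sup>2 \<le> x \<bullet> (M \<Lambda> z *v x)})"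
  have S_Lplus: "\<Lambda> \<in> Lplus \<nu> W G" if "\<Lambda> \<in> S" for \<Lambda>
    using that by (intro Lplus_if_coercive[OF _ c]) (auto simp: S_def)
  have super: "\<Lambda> \<in> S" if "\<Lambda> \<in> Lplus \<nu> W G" "Jnu \<nu> W G 0 \<le> Jnu \<nu> W G \<Lambda>" for \<Lambda>
    using that RK coercive LplusD(1)[OF that(1)] by (auto simp: S_def)
  have "compact S"
  proof -
    have "closed {\<Lambda>. c * (norm x)\<^sup>2 \<le> x \<bullet> (M \<Lambda> z *v x)}" for x z
      unfolding M_eq by (intro closed_Collect_le continuous_intros)
    then have "closed (\<Inter>z\<in>circ. \<Inter>x. {\<Lambda>. c * (norm x)\<^sup>2 \<le> x \<bullet> (M \<Lambda> z *v x)})"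
      by (intro closed_INT ballI)
    moreover have "compact (QG G \<inter> cball 0 R)"
      by (intro closed_Int_compact closed_subspace[OF subspace_QG] compact_cball)
    ultimately show ?thesis
      unfolding S_def by (rule compact_Int_closed[rotated])
  qed
  moreover have "0 \<in> S" using super[OF zero_in_Lplus] by simp
  moreover have "continuous_on S (Jnu \<nu> W G)"
    by (rule continuous_on_subset[OF continuous_Jnu]) (use S_Lplus in blast)
  ultimately have "\<exists>\<Lambda>0\<in>S. \<forall>\<Lambda>\<in>S. Jnu \<nu> W G \<Lambda> \<le> Jnu \<nu> W G \<Lambda>0"
    by (intro continuous_attains_sup) auto
  then obtain \<Lambda>0 where \<Lambda>0: "\<Lambda>0 \<in> S" "\<forall>\<Lambda>\<in>S. Jnu \<nu> W G \<Lambda> \<le> Jnu \<nu> W G \<Lambda>0" by auto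
  have "Jnu \<nu> W G \<Lambda> \<le> Jnu \<nu> W G \<Lambda>0" if "\<Lambda> \<in> Lplus \<nu> W G" for \<Lambda>
  proof (cases "Jnu \<nu> W G 0 \<le> Jnu \<nu> W G \<Lambda>")
    case True
    then show ?thesis using super[OF that] \<Lambda>0(2) by blast
  next
    case False
    moreover have "Jnu \<nu> W G 0 \<le> Jnu \<nu> W G \<Lambda>0" using \<Lambda>0(2) \<open>0 \<in> S\<close> by blast
    ultimately show ?thesis by linarith
  qed
  moreover have "\<forall>z\<in>circ. \<forall>x. c * (norm x)\<^sup>2 \<le> x \<bullet> (M \<Lambda>0 z *v x)"
    using \<Lambda>0(1) by (auto simp: S_def)
  ultimately show ?thesis using S_Lplus[OF \<Lambda>0(1)] c by blast
qed

lemma Jnu_le_tangent: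
  assumes "\<Lambda> \<in> Lplus \<nu> W G" "\<Lambda>' \<in> Lplus \<nu> W G"
  shows "Jnu \<nu> W G \<Lambda>' \<le> Jnu \<nu> W G \<Lambda> + grad \<Lambda> \<bullet> (\<Lambda>' - \<Lambda>)"
proof -
  have "0 \<le> cint (gap \<Lambda> \<Lambda>')"
    by (intro cint_nonneg cintegrable_continuous continuous_gap gap_nonneg assms)
  then have "0 \<le> real \<nu> / (real \<nu> - 1) * cint (gap \<Lambda> \<Lambda>')"
    using nu by (intro mult_nonneg_nonneg) auto
  then show ?thesis using Jnu_expansion[OF assms] by linarith
qed

text \<open>Concavity replaces differentiation here: moving from the maximizer along its own
  supergradient, the supergradients at the displaced points cannot point forward, and neither can
  their limit.\<close>

lemma grad_eq_0:
  assumes \<Lambda>0: "\<Lambda>0 \<in> Lplus \<nu> W G" and c: "0 < c"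
    and coercive: "\<And>z x. z \<in> circ \<Longrightarrow> c * (norm x)\<^sup>2 \<le> x \<bullet> (M \<Lambda>0 z *v x)"
    and max: "\<And>\<Lambda>. \<Lambda> \<in> Lplus \<nu> W G \<Longrightarrow> Jnu \<nu> W G \<Lambda> \<le> Jnu \<nu> W G \<Lambda>0"
  shows "grad \<Lambda>0 = 0"
proof -
  define \<delta> where "\<delta> = grad \<Lambda>0"
  have \<delta>: "\<delta> \<in> QG G" unfolding \<delta>_def by (rule grad_in_QG[OF \<Lambda>0])
  have "continuous_on circ (\<lambda>z. ctrans (P z) ** \<delta> ** P z)"
    by (intro continuous_intros continuous_P)
  from compact_norm_bound[OF compact_circ this]
  obtain C where C: "0 \<le> C" "\<forall>z\<in>circ. norm (ctrans (P z) ** \<delta> ** P z) \<le> C" by blast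
  \<comment> \<open>For \<open>t\<close> up to \<open>t0\<close> the perturbation costs at most half
    of the coercivity \<open>c\<close>; \<open>C + 1\<close> avoids a zero denominator.\<close>
  define t0 where "t0 = c / (2 * (C + 1))"
  have t0: "0 < t0" using c C(1) by (simp add: t0_def)
  have in_Lplus: "\<Lambda>0 + t *\<^sub>R \<delta> \<in> Lplus \<nu> W G" if t: "t \<in> {0..t0}" for t
  proof (rule Lplus_if_coercive)
    show "\<Lambda>0 + t *\<^sub>R \<delta> \<in> QG G"
      by (intro subspace_add[OF subspace_QG] subspace_scale[OF subspace_QG] \<delta> LplusD(1)[OF \<Lambda>0])
    show "0 < c / 2" using c by simp
    fix z x assume z: "z \<in> circ"
    define E where "E = ctrans (P z) ** \<delta> ** P z"
    have "\<bar>x \<bullet> (E *v x)\<bar> \<le> norm x * (norm E * norm x)"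
      by (rule order_trans[OF Cauchy_Schwarz_ineq2 mult_left_mono[OF norm_matrix_vector_mult_le]]) simp
    also have "\<dots> \<le> norm x * (C * norm x)"
      using C z by (intro mult_left_mono mult_right_mono) (auto simp: E_def)
    finally have E: "\<bar>x \<bullet> (E *v x)\<bar> \<le> C * (norm x)\<^sup>2" by (simp add: power2_eq_square mult.left_commute)
    have "t * C \<le> t0 * (C + 1)" using t C t0 by (intro mult_mono) auto
    also have "\<dots> = c / 2" using C(1) by (simp add: t0_def field_simps)
    finally have tC: "t * C \<le> c / 2" .
    have "t / real \<nu> \<le> t" using t nu by (simp add: divide_le_eq mult_le_cancel_left1)
    have "\<bar>t / real \<nu> * (x \<bullet> (E *v x))\<bar> = t / real \<nu> * \<bar>x \<bullet> (E *v x)\<bar>"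
      using t by (simp add: abs_mult)
    also have "\<dots> \<le> t * (C * (norm x)\<^sup>2)"
      using \<open>t / real \<nu> \<le> t\<close> E t by (intro mult_mono) auto
    also have "\<dots> \<le> c / 2 * (norm x)\<^sup>2"
      using mult_right_mono[OF tC, of "(norm x)\<^sup>2"] by (simp add: mult.assoc)
    finally have small: "\<bar>t / real \<nu> * (x \<bullet> (E *v x))\<bar> \<le> c / 2 * (norm x)\<^sup>2" .
    have "M (\<Lambda>0 + t *\<^sub>R \<delta>) z = M \<Lambda>0 z + (t / real \<nu>) *\<^sub>R E"
      by (simp add: M_eq E_def matrix_mult_algebra scaleR_add_right)
    then have "x \<bullet> (M (\<Lambda>0 + t *\<^sub>R \<delta>) z *v x) = x \<bullet> (M \<Lambda>0 z *v x) + t / real \<nu> * (x \<bullet> (E *v x))"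
      by (simp only: matrix_vector_mult_algebra inner_add_right inner_scaleR_right)
    then show "c / 2 * (norm x)\<^sup>2 \<le> x \<bullet> (M (\<Lambda>0 + t *\<^sub>R \<delta>) z *v x)"
      using small coercive[OF z, of x] by (simp only: abs_le_iff) linarith
  qed
  define \<phi> where "\<phi> t = grad (\<Lambda>0 + t *\<^sub>R \<delta>) \<bullet> \<delta>" for t
  \<comment> \<open>The tangent at the displaced point, evaluated back at \<open>\<Lambda>0\<close>,
    bounds the maximum by itself minus \<open>t * \<phi> t\<close>.\<close>
  have neg: "\<phi> t \<le> 0" if "t \<in> {0..t0}" "0 < t" for t
  proof -
    have "Jnu \<nu> W G \<Lambda>0 \<le> Jnu \<nu> W G (\<Lambda>0 + t *\<^sub>R \<delta>) + grad (\<Lambda>0 + t *\<^sub>R \<delta>) \<bullet> (\<Lambda>0 - (\<Lambda>0 + t *\<^sub>R \<delta>))"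
      by (rule Jnu_le_tangent[OF in_Lplus[OF that(1)] \<Lambda>0])
    also have "\<dots> \<le> Jnu \<nu> W G \<Lambda>0 - t * \<phi> t"
      using max[OF in_Lplus[OF that(1)]] by (simp add: \<phi>_def)
    finally show ?thesis using that(2) by (simp add: mult_le_0_iff)
  qed
  have cont: "continuous_on {0..t0} \<phi>"
    unfolding \<phi>_def
    by (intro continuous_intros continuous_on_compose2[OF continuous_grad]) (use in_Lplus in auto)
  have "\<phi> 0 \<le> 0"
  proof (rule ccontr)
    assume "\<not> \<phi> 0 \<le> 0"
    then obtain d where d: "0 < d" "\<forall>t\<in>{0..t0}. dist t 0 < d \<longrightarrow> dist (\<phi> t) (\<phi> 0) < \<phi> 0"
      using cont t0 unfolding continuous_on_iff by (metis atLeastAtMost_iff less_imp_le order_refl not_le)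
    define t where "t = min t0 (d / 2)"
    have t: "t \<in> {0..t0}" "0 < t" "dist t 0 < d" using t0 d(1) by (auto simp: t_def)
    then have "dist (\<phi> t) (\<phi> 0) < \<phi> 0" using d(2) by blast
    then show False using neg[OF t(1,2)] by (simp add: dist_real_def)
  qed
  then have "\<delta> \<bullet> \<delta> \<le> 0" by (simp add: \<phi>_def \<delta>_def)
  then have "\<delta> \<bullet> \<delta> = 0" by (rule antisym) simp
  then show ?thesis by (simp add: \<delta>_def)
qed

lemma dual_problem_solution:
  "\<exists>\<Lambda>0. \<Lambda>0 \<in> Lplus \<nu> W G
    \<and> (\<forall>\<Lambda>\<in>Lplus \<nu> W G. Jnu \<nu> W G \<Lambda> \<le> Jnu \<nu> W G \<Lambda>0)
    \<and> (\<forall>\<Lambda>1. \<Lambda>1 \<in> Lplus \<nu> W G \<and> (\<forall>\<Lambda>\<in>Lplus \<nu> W G. Jnu \<nu> W G \<Lambda> \<le> Jnu \<nu> W G \<Lambda>1) \<longrightarrow> \<Lambda>1 = \<Lambda>0)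
    \<and> cint (\<lambda>z. G z ** Phinu \<nu> W G \<Lambda>0 z ** ctrans (G z)) = mat 1"
proof -
  obtain \<Lambda>0 c where \<Lambda>0: "\<Lambda>0 \<in> Lplus \<nu> W G" and c: "0 < c"
    "\<forall>z\<in>circ. \<forall>x. c * (norm x)\<^sup>2 \<le> x \<bullet> (M \<Lambda>0 z *v x)"
    and max: "\<forall>\<Lambda>\<in>Lplus \<nu> W G. Jnu \<nu> W G \<Lambda> \<le> Jnu \<nu> W G \<Lambda>0"
    using maximizer_exists by blast
  have grad0: "grad \<Lambda>0 = 0"
    by (rule grad_eq_0[OF \<Lambda>0 c(1)]) (use c(2) max in auto)
  have unique: "\<Lambda>1 = \<Lambda>0"
    if \<Lambda>1: "\<Lambda>1 \<in> Lplus \<nu> W G" and max1: "\<forall>\<Lambda>\<in>Lplus \<nu> W G. Jnu \<nu> W G \<Lambda> \<le> Jnu \<nu> W G \<Lambda>1" for \<Lambda>1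
  proof -
    have "Jnu \<nu> W G \<Lambda>1 = Jnu \<nu> W G \<Lambda>0"
      using max max1 \<Lambda>0 \<Lambda>1 by (intro antisym) auto
    \<comment> \<open>With a zero supergradient the expansion at \<open>\<Lambda>0\<close> leaves
      only the integral of \<open>gap\<close>, so equal values make it vanish.\<close>
    then have "cint (gap \<Lambda>0 \<Lambda>1) = 0"
      using Jnu_expansion[OF \<Lambda>0 \<Lambda>1] grad0 nu by simp
    then have "gap \<Lambda>0 \<Lambda>1 z = 0" if "z \<in> circ" for z
      by (intro cint_eq_0_imp[OF continuous_gap[OF \<Lambda>0 \<Lambda>1] _ _ that] gap_nonneg[OF \<Lambda>0 \<Lambda>1])
    then have "M \<Lambda>0 z = M \<Lambda>1 z" if "z \<in> circ" for z
      using gap_eq_0_imp[OF \<Lambda>0 \<Lambda>1 that] that by blast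
    then show ?thesis
      using QG_eq_if_M_eq[OF LplusD(1)[OF \<Lambda>0] LplusD(1)[OF \<Lambda>1]] by simp
  qed
  have "cint (\<lambda>z. G z ** Phinu \<nu> W G \<Lambda>0 z ** ctrans (G z)) = mat 1"
    using grad0 by (simp add: grad_def moment_def)
  then show ?thesis using \<Lambda>0 max unique by blast
qed

end

theorem theorem1:
  fixes \<nu> :: nat
    and A :: "real^'n^'n" and B :: "((real, 'm::{finite,linorder}) vec, 'n) vec" and Sig :: "real^'n^'n"
    and \<Psi> W :: "complex \<Rightarrow> ((complex, 'm) vec, 'm) vec"
  assumes nu: "\<nu> > 1"
    and dims: "CARD('n) > CARD('m)"
    and A_stable: "stable A"
    and B_rank: "rank B = CARD('m)"
    and reach: "reachable A B"
    and Sig_pd: "rposdef Sig"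
    and Psi_S: "\<Psi> \<in> Splus"
    and Psi_rat: "rational_on_circ \<Psi>"
    and W_fac: "canonical_left_factor W \<Psi>"
    and J_ne: "\<exists>\<Phi>\<in>Splus. cint (\<lambda>z. Gfun Sig A B z ** \<Phi> z ** ctrans (Gfun Sig A B z)) = mat 1"
  shows "\<exists>\<Lambda>0. \<Lambda>0 \<in> Lplus \<nu> W (Gfun Sig A B)
            \<and> (\<forall>\<Lambda>\<in>Lplus \<nu> W (Gfun Sig A B). Jnu \<nu> W (Gfun Sig A B) \<Lambda> \<le> Jnu \<nu> W (Gfun Sig A B) \<Lambda>0)
            \<and> (\<forall>\<Lambda>1. \<Lambda>1 \<in> Lplus \<nu> W (Gfun Sig A B)
                 \<and> (\<forall>\<Lambda>\<in>Lplus \<nu> W (Gfun Sig A B). Jnu \<nu> W (Gfun Sig A B) \<Lambda> \<le> Jnu \<nu> W (Gfun Sig A B) \<Lambda>1)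
                 \<longrightarrow> \<Lambda>1 = \<Lambda>0)
            \<and> cint (\<lambda>z. Gfun Sig A B z ** Phinu \<nu> W (Gfun Sig A B) \<Lambda>0 z ** ctrans (Gfun Sig A B z)) = mat 1"
proof -
  \<comment> \<open>Stability keeps the resolvent regular on the circle, while \<open>W\<close> has
    its poles inside the disk and a nonzero determinant on the circle.\<close>
  interpret dual_problem \<nu> "Gfun Sig A B" W
  proof
    show "1 < \<nu>" by (fact nu)
    show "\<exists>L. L-lipschitz_on circ (Gfun Sig A B)" by (rule lipschitz_on_Gfun[OF A_stable])
    show "\<exists>L. L-lipschitz_on circ W" by (rule lipschitz_on_canonical_left_factor[OF W_fac])
    show "invertible (W z)" if "z \<in> circ" for z
      using W_fac that by (auto simp: canonical_left_factor_def circ_def invertible_det_nz)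
    show "\<exists>\<Phi>\<in>Splus. cint (\<lambda>z. Gfun Sig A B z ** \<Phi> z ** ctrans (Gfun Sig A B z)) = mat 1"
      by (fact J_ne)
  qed
  show ?thesis by (rule dual_problem_solution)
qed

end
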